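(* Let $n\ge1$ be an integer and fix some $R>0$. Suppose $F:\mathbb{R}\to\mathbb{R}$ is a $C^1$ function with $F(0)=0$ and $$F'(u)\ge0,\qquad F(u)\ge Au^p\qquad\text{on }[0,\infty)$$ for some $A>0$ and $p>1$. Suppose also that $V:(R,\infty)\to\mathbb{R}$ is $C^1$ and non-positive. Let $\psi:(R,\infty)\to\mathbb{R}$ be a continuous function with $$\psi(r)\ge\varepsilon r^{-k-1}\qquad\text{on }(R,\infty)$$ for some $\varepsilon>0$ and some $0\le k<2/(p-1)$. With $g(r,u)=F(u)-V(r)\,u$, consider the unique solution $u$, in the class described in the context, of $$\partial_t^2u-\partial_r^2u-\frac{n-1}{r}\,\partial_ru=g(r,u)\ \text{ in }\Theta_T,\qquad u(r,0)=0,\quad\partial_tu(r,0)=\psi(r)\ \text{ in }(R,\infty).$$ If $T$ denotes the lifespan of $u$, then $$T\le C\varepsilon^{-(p-1)/(2-k(p-1))}$$ for some constant $C$ that is independent of $\varepsilon$.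
   Context: $\mathbb{R}_+=(0,\infty)$ and, for $T>0$, $\Theta_T=\{(r,t)\in\mathbb{R}_+^2: r>t+R,\ 0\le t<T\}$. Solutions are required to be continuous, locally bounded and of locally finite energy in $\Theta_T$, namely such that $u\in L^\infty_{\rm loc}(\Theta_T)$ and $r^{(n-1)/2}(|u|+|\partial_ru|+|\partial_tu|)\in L^2_{\rm loc}(\Theta_T)$. For $g$ and $\psi$ as in the claim, there exist some $T>0$ and a unique such solution in $\Theta_T$. The lifespan of $u$ is the supremum of the times $T$ for which this solution exists in $\Theta_T$.
   Formalization: The constant C is uniform over 0 < ε ≤ ε₀ for an arbitrary fixed ε₀ > 0 and may depend on ε₀; a single C for all ε > 0 fails as ε → ∞, e.g. n = 1, V = 0, F(u) = |u|^p, ψ = ε r^{-k-1}. *)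

theory Defs
  imports "HOL-Analysis.Analysis"
begin

text \<open>Points of the plane are pairs \<open>(r, t)\<close>.\<close>

definition Theta :: "real \<Rightarrow> real \<Rightarrow> (real \<times> real) set" where
  "Theta R T = {(r, t). r > t + R \<and> 0 \<le> t \<and> t < T}"

text \<open>\<open>\<phi>\<close> is a compactly supported \<open>C\<^sup>1\<close> function on the open set \<open>U\<close>, extended by zero,
  with partial derivatives \<open>\<phi>r\<close> and \<open>\<phi>t\<close>. Only first derivatives of test functions are used below,
  and all functions paired with them are locally integrable, so \<open>C\<^sup>1\<close> and \<open>C\<^sup>\<infinity>\<close> test functions
  give the same notions (by mollification).\<close>

definition test_function ::
  "(real \<times> real) set \<Rightarrow> (real \<times> real \<Rightarrow> real) \<Rightarrow> (real \<times> real \<Rightarrow> real) \<Rightarrow> (real \<times> real \<Rightarrow> real) \<Rightarrow> bool"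
  where
  "test_function U \<phi> \<phi>r \<phi>t \<longleftrightarrow>
     (\<forall>z. (\<phi> has_derivative (\<lambda>h. \<phi>r z * fst h + \<phi>t z * snd h)) (at z)) \<and>
     continuous_on UNIV \<phi>r \<and> continuous_on UNIV \<phi>t \<and>
     (\<exists>K. compact K \<and> K \<subseteq> U \<and> (\<forall>z. z \<notin> K \<longrightarrow> \<phi> z = 0))"

definition L2_loc :: "(real \<times> real) set \<Rightarrow> (real \<times> real \<Rightarrow> real) \<Rightarrow> bool" where
  "L2_loc S f \<longleftrightarrow> set_borel_measurable lborel S f \<and>
     (\<forall>K. compact K \<and> K \<subseteq> S \<longrightarrow> set_integrable lborel K (\<lambda>z. (f z)\<^sup>2))"

definition weak_partials ::
  "(real \<times> real) set \<Rightarrow> (real \<times> real \<Rightarrow> real) \<Rightarrow> (real \<times> real \<Rightarrow> real) \<Rightarrow> (real \<times> real \<Rightarrow> real) \<Rightarrow> bool"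
  where
  "weak_partials U u ur ut \<longleftrightarrow>
     (\<forall>\<phi> \<phi>r \<phi>t. test_function U \<phi> \<phi>r \<phi>t \<longrightarrow>
        (LINT z:U|lborel. u z * \<phi>r z) = - (LINT z:U|lborel. ur z * \<phi> z) \<and>
        (LINT z:U|lborel. u z * \<phi>t z) = - (LINT z:U|lborel. ut z * \<phi> z))"

text \<open>The solution class: continuous, locally bounded, of locally finite energy. Compact subsets of
  \<open>Theta R T\<close> may touch the initial line \<open>t = 0\<close>, but not the cone \<open>r = t + R\<close>.
  The radial weight \<open>r powr ((n - 1) / 2)\<close> is that of the \<open>n\<close>-dimensional volume element.\<close>

definition solution_class ::
  "nat \<Rightarrow> real \<Rightarrow> real \<Rightarrow> (real \<times> real \<Rightarrow> real) \<Rightarrow> (real \<times> real \<Rightarrow> real) \<Rightarrow> (real \<times> real \<Rightarrow> real) \<Rightarrow> bool"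
  where
  "solution_class n R T u ur ut \<longleftrightarrow>
     continuous_on (Theta R T) u \<and>
     (\<forall>K. compact K \<and> K \<subseteq> Theta R T \<longrightarrow> bounded (u ` K)) \<and>
     set_borel_measurable lborel (Theta R T) ur \<and>
     set_borel_measurable lborel (Theta R T) ut \<and>
     weak_partials (interior (Theta R T)) u ur ut \<and>
     L2_loc (Theta R T) (\<lambda>z. fst z powr ((real n - 1) / 2) * (\<bar>u z\<bar> + \<bar>ur z\<bar> + \<bar>ut z\<bar>))"

text \<open>Weak solutions of
    \<open>u_tt - u_rr - ((n - 1) / r) u_r = g(r, u)\<close> in \<open>Theta R T\<close>, \<open>u(r, 0) = 0\<close>, \<open>u_t(r, 0) = \<psi>(r)\<close>.
  The equation is multiplied by \<open>r ^ (n - 1) * \<phi>\<close>, which puts the radial part in the form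
  \<open>(r ^ (n - 1) * u_r)_r\<close>, and integrated by parts once. The test functions need not vanish on
  \<open>t = 0\<close>, and the resulting boundary term carries the initial condition for \<open>u_t\<close>; it has no
  pointwise meaning because \<open>u_t\<close> is only locally square integrable.
  All integrands are supported in compact subsets of \<open>Theta R T\<close> (resp. of \<open>r > R\<close>), because the
  support of \<open>\<phi>\<close> meets \<open>t \<ge> 0\<close> only there.\<close>

definition is_solution ::
  "nat \<Rightarrow> real \<Rightarrow> real \<Rightarrow> (real \<Rightarrow> real \<Rightarrow> real) \<Rightarrow> (real \<Rightarrow> real) \<Rightarrow> (real \<times> real \<Rightarrow> real) \<Rightarrow> bool"
  where
  "is_solution n R T g \<psi> u \<longleftrightarrow>
     (\<exists>ur ut. solution_class n R T u ur ut \<and>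
        (\<forall>r>R. u (r, 0) = 0) \<and>
        (\<forall>\<phi> \<phi>r \<phi>t. test_function {(r, t). r > t + R \<and> r > R \<and> t < T} \<phi> \<phi>r \<phi>t \<longrightarrow>
           (LINT z:Theta R T|lborel.
              fst z ^ (n - 1) * (ur z * \<phi>r z - ut z * \<phi>t z - g (fst z) (u z) * \<phi> z))
           = (LINT r:{R<..}|lborel. r ^ (n - 1) * \<psi> r * \<phi> (r, 0))))"

definition lifespan :: "nat \<Rightarrow> real \<Rightarrow> (real \<Rightarrow> real \<Rightarrow> real) \<Rightarrow> (real \<Rightarrow> real) \<Rightarrow> ennreal" where
  "lifespan n R g \<psi> = (SUP T \<in> {T. 0 < T \<and> (\<exists>u. is_solution n R T g \<psi> u)}. ennreal T)"

end

theory Submission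
  imports Defs
begin

text \<open>Put \<open>m = (n - 1) / 2\<close>. The function \<open>w = r powr m * u\<close> satisfies the one-dimensional equation
  \<open>w_tt - w_rr + (m (m - 1) / r^2) w = r powr m * g(r, u)\<close>, so d'Alembert's formula
  (\<open>dalembert_formula\<close>) expresses \<open>2 w(P)\<close> as the integral of \<open>\<rho> powr m * \<psi>\<close> over the base of the
  backward triangle \<open>past P\<close> plus the integral of \<open>\<rho> powr m * g - (m (m - 1) / \<rho>^2) w\<close> over this
  triangle.

  In high dimensions the inverse-square term makes the fundamental solution change sign near the cone
  \<open>r = t + R\<close>, so positivity of \<open>u\<close> cannot be expected in the whole domain. It does hold far
  from the cone: on a time interval of length \<open>\<tau>\<close> and at radii at least \<open>M * \<tau>\<close>, with \<open>M\<close> depending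
  on \<open>n\<close> only, the potential is at most a small multiple of \<open>1 / \<tau>^2\<close>, while the triangles have area of
  order \<open>\<tau>^2\<close>. Its effect is then absorbed (\<open>duhamel_comparison\<close>): \<open>w\<close> is nonnegative and is bounded
  below by a fixed fraction of the contribution of the data and of the nonlinearity. This loses
  nothing, since all radii between \<open>M * \<tau>\<close> and \<open>(M + 3) * \<tau>\<close> are comparable with \<open>\<tau>\<close> and the
  claimed bound is exactly the one dictated by scaling.

  In such a region, \<open>w\<close> is at least \<open>B\<close>, of size \<open>\<epsilon> \<tau> powr (m - k)\<close>, after the time \<open>\<tau> / 2\<close>, and
  \<open>w(P)\<close> is at least \<open>\<kappa>\<close> times the integral of \<open>w powr p\<close> over \<open>past P\<close>, where \<open>\<kappa>\<close> has size
  \<open>\<tau> powr (- m (p - 1))\<close>. A lower bound \<open>b\<close> valid in the future of a point doubles after a further time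
  of order \<open>(\<kappa> * b powr (p - 1)) powr (- 1 / 2)\<close>. These waiting times form a geometric series; if its sum
  were smaller than \<open>\<tau> / 2\<close>, then \<open>w\<close> would be infinite at time \<open>\<tau>\<close> (\<open>doubling_bound\<close>). Hence
  \<open>\<kappa> * B powr (p - 1) * \<tau>^2\<close> is bounded, which says that \<open>\<epsilon> powr (p - 1) * \<tau> powr (2 - k (p - 1))\<close> is
  bounded (\<open>wave_blowup_estimate\<close>).

  The passage from the weak formulation to d'Alembert's formula uses test functions of the form
  \<open>f(r + t) h(t - r)\<close>, on which the one-dimensional wave operator acts as \<open>4 f' h'\<close>. Taking for \<open>f\<close> and
  \<open>h\<close> smoothed decreasing steps, \<open>f h\<close> approximates the indicator function of the triangle and \<open>4 f' h'\<close>
  twice the point mass at its vertex.\<close>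

section \<open>A twice differentiable step function\<close>

definition ramp :: "real \<Rightarrow> real" where
  "ramp x = max 0 (min 1 x)"

lemma ramp_bounds: "0 \<le> ramp x" "ramp x \<le> 1"
  and ramp_lipschitz: "\<bar>ramp x - ramp y\<bar> \<le> \<bar>x - y\<bar>"
  by (auto simp: ramp_def max_def min_def abs_if)

lemma continuous_ramp: "continuous_on A ramp"
  unfolding ramp_def by (intro continuous_intros)

text \<open>A \<open>C1\<close> function whose derivative vanishes at \<open>0\<close> and \<open>1\<close> stays \<open>C1\<close> when it is frozen outside the
  unit interval. Where the clamped value is \<open>0\<close> or \<open>1\<close>, Caratheodory's quotient tends to \<open>0\<close>
  and clamping does not increase distances, so the difference quotient tends to \<open>0\<close> as well; this
  includes the two corners.\<close>

lemma has_derivative_comp_ramp: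
  fixes P Q :: "real \<Rightarrow> real"
  assumes P: "\<And>x. (P has_real_derivative Q x) (at x)" and Q: "Q 0 = 0" "Q 1 = 0"
  shows "((\<lambda>x. P (ramp x)) has_real_derivative Q (ramp x)) (at x)"
proof (cases "0 < x \<and> x < 1")
  case True
  have "((\<lambda>x. P (ramp x)) has_real_derivative Q x) (at x)"
  proof (rule DERIV_cong_ev[THEN iffD2])
    show "\<forall>\<^sub>F y in nhds x. P (ramp y) = P y"
      using eventually_nhds_in_open[of "{0<..<1}" x] True
      by (auto elim!: eventually_mono simp: ramp_def)
  qed (use P in auto)
  with True show ?thesis by (simp add: ramp_def)
next
  case False
  then have "ramp x = 0 \<or> ramp x = 1" by (auto simp: ramp_def)
  then have Q0: "Q (ramp x) = 0" using Q by auto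
  obtain g where g: "\<And>y. P y - P (ramp x) = g y * (y - ramp x)" "isCont g (ramp x)" "g (ramp x) = 0"
    using P[of "ramp x"] unfolding CARAT_DERIV Q0 by auto
  have "isCont ramp x"
    using continuous_ramp[of UNIV] by (simp add: continuous_on_eq_continuous_at)
  then have "isCont (\<lambda>y. g (ramp y)) x"
    using g(2) by (simp add: isCont_o2)
  then have *: "(\<lambda>y. \<bar>g (ramp y)\<bar>) \<midarrow>x\<rightarrow> 0"
    using g(3) by (auto simp: isCont_def intro!: tendsto_eq_intros)
  have "(\<lambda>y. (P (ramp y) - P (ramp x)) / (y - x)) \<midarrow>x\<rightarrow> 0"
  proof (rule Lim_null_comparison[OF _ *])
    have "\<bar>(P (ramp y) - P (ramp x)) / (y - x)\<bar> \<le> \<bar>g (ramp y)\<bar>" for y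
    proof (cases "y = x")
      case False
      have "\<bar>g (ramp y)\<bar> * \<bar>ramp y - ramp x\<bar> \<le> \<bar>g (ramp y)\<bar> * \<bar>y - x\<bar>"
        using ramp_lipschitz by (intro mult_left_mono) auto
      then show ?thesis
        using False by (simp add: g(1) abs_mult abs_divide divide_le_eq)
    qed auto
    then show "\<forall>\<^sub>F y in at x. norm ((P (ramp y) - P (ramp x)) / (y - x)) \<le> \<bar>g (ramp y)\<bar>"
      by simp
  qed
  then show ?thesis using Q0 by (simp add: has_field_derivative_iff)
qed

text \<open>The quintic \<open>10 x^3 - 15 x^4 + 6 x^5\<close> on the unit interval, continued by \<open>0\<close> and \<open>1\<close>. Its derivative
  \<open>30 x^2 (1 - x)^2\<close> has double zeros at both ends, which makes the step twice continuously
  differentiable; the two constants below are its derivatives. Two derivatives are needed because the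
  radial and the time derivative of a test function have to be test functions themselves.\<close>

definition smoothstep :: "real \<Rightarrow> real" where
  "smoothstep x = ramp x ^ 3 * (10 - 15 * ramp x + 6 * ramp x ^ 2)"
definition smoothstep_d1 :: "real \<Rightarrow> real" where
  "smoothstep_d1 x = 30 * (ramp x * (1 - ramp x)) ^ 2"
definition smoothstep_d2 :: "real \<Rightarrow> real" where
  "smoothstep_d2 x = 60 * (ramp x * (1 - ramp x) * (1 - 2 * ramp x))"

lemma DERIV_smoothstep:
  "(smoothstep has_real_derivative smoothstep_d1 x) (at x)"
  unfolding smoothstep_def[abs_def] smoothstep_d1_def
  by (rule has_derivative_comp_ramp[of "\<lambda>c. c^3 * (10 - 15 * c + 6 * c ^ 2)" "\<lambda>c. 30 * (c * (1 - c)) ^ 2"])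
     (auto intro!: derivative_eq_intros simp: algebra_simps power2_eq_square power3_eq_cube)

lemma DERIV_smoothstep_d1:
  "(smoothstep_d1 has_real_derivative smoothstep_d2 x) (at x)"
  unfolding smoothstep_d1_def[abs_def] smoothstep_d2_def
  by (rule has_derivative_comp_ramp[of "\<lambda>c. 30 * (c * (1 - c)) ^ 2" "\<lambda>c. 60 * (c * (1 - c) * (1 - 2 * c))"])
     (auto intro!: derivative_eq_intros simp: algebra_simps power2_eq_square power3_eq_cube)

lemma continuous_smoothstep_d2: "continuous_on A smoothstep_d2"
  unfolding smoothstep_d2_def by (intro continuous_intros continuous_ramp)

lemma continuous_smoothstep: "continuous_on A smoothstep"
  unfolding smoothstep_def by (intro continuous_intros continuous_ramp)

lemma continuous_smoothstep_d1: "continuous_on A smoothstep_d1"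
  unfolding smoothstep_d1_def by (intro continuous_intros continuous_ramp)

lemma smoothstep_left: "x \<le> 0 \<Longrightarrow> smoothstep x = 0" "x \<le> 0 \<Longrightarrow> smoothstep_d1 x = 0" "x \<le> 0 \<Longrightarrow> smoothstep_d2 x = 0"
  and smoothstep_right: "1 \<le> x \<Longrightarrow> smoothstep x = 1" "1 \<le> x \<Longrightarrow> smoothstep_d1 x = 0" "1 \<le> x \<Longrightarrow> smoothstep_d2 x = 0"
  by (auto simp: smoothstep_def smoothstep_d1_def smoothstep_d2_def ramp_def)

lemma smoothstep_d1_bounds: "0 \<le> smoothstep_d1 x" "smoothstep_d1 x \<le> 30"
proof -
  show "0 \<le> smoothstep_d1 x" by (simp add: smoothstep_d1_def)
  have "ramp x * (1 - ramp x) \<le> 1 * 1"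
    using ramp_bounds[of x] by (intro mult_mono) auto
  then have "(ramp x * (1 - ramp x))^2 \<le> 1^2"
    using ramp_bounds[of x] by (intro power_mono) auto
  then show "smoothstep_d1 x \<le> 30" by (simp add: smoothstep_d1_def)
qed

lemma smoothstep_bounds: "0 \<le> smoothstep x" "smoothstep x \<le> 1"
proof -
  have mono: "mono smoothstep"
  proof (rule monoI)
    show "smoothstep x \<le> smoothstep y" if "x \<le> y" for x y
      by (rule DERIV_nonneg_imp_nondecreasing[OF that]) (use DERIV_smoothstep smoothstep_d1_bounds(1) in blast)
  qed
  show "0 \<le> smoothstep x"
    using monoD[OF mono, of "min 0 x" x] by (simp add: smoothstep_left)
  show "smoothstep x \<le> 1"
    using monoD[OF mono, of x "max 1 x"] by (simp add: smoothstep_right)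
qed

section \<open>Calculus of test functions\<close>

lemma test_function_has_derivative:
  "test_function U \<phi> \<phi>r \<phi>t \<Longrightarrow> (\<phi> has_derivative (\<lambda>h. \<phi>r z * fst h + \<phi>t z * snd h)) (at z)"
  unfolding test_function_def by blast

lemma test_function_support:
  assumes "test_function U \<phi> \<phi>r \<phi>t"
  obtains K where "compact K" "K \<subseteq> U" "\<And>z. z \<notin> K \<Longrightarrow> \<phi> z = 0 \<and> \<phi>r z = 0 \<and> \<phi>t z = 0"
proof -
  obtain K where K: "compact K" "K \<subseteq> U" "\<And>z. z \<notin> K \<Longrightarrow> \<phi> z = 0"
    using assms by (auto simp: test_function_def)
  have "\<phi>r z = 0 \<and> \<phi>t z = 0" if z: "z \<notin> K" for z
  proof -
    have "((\<lambda>_. 0::real) has_derivative (\<lambda>h. \<phi>r z * fst h + \<phi>t z * snd h)) (at z)"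
    proof (rule has_derivative_transform_within_open)
      show "(\<phi> has_derivative (\<lambda>h. \<phi>r z * fst h + \<phi>t z * snd h)) (at z)"
        using assms by (rule test_function_has_derivative)
      show "open (- K)" using K(1) by (simp add: compact_imp_closed open_Compl)
    qed (use z K in auto)
    then have "(\<lambda>h. \<phi>r z * fst h + \<phi>t z * snd h) = (\<lambda>h. 0)"
      using has_derivative_unique has_derivative_const by blast
    from fun_cong[OF this, of "(1,0)"] fun_cong[OF this, of "(0,1)"] show ?thesis by auto
  qed
  with K show ?thesis using that by blast
qed

text \<open>Derivatives and their continuity have to be checked on \<open>U\<close> only: the complement of \<open>K\<close> is open, and
  everything vanishes there. This allows factors such as powers of \<open>r\<close> that are regular on \<open>U\<close> only.\<close>

lemma test_functionI:
  assumes "open U" "compact K" "K \<subseteq> U"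
    and d: "\<And>z. z \<in> U \<Longrightarrow> (\<phi> has_derivative (\<lambda>h. \<phi>r z * fst h + \<phi>t z * snd h)) (at z)"
    and c: "continuous_on U \<phi>r" "continuous_on U \<phi>t"
    and 0: "\<And>z. z \<notin> K \<Longrightarrow> \<phi> z = 0 \<and> \<phi>r z = 0 \<and> \<phi>t z = 0"
  shows "test_function U \<phi> \<phi>r \<phi>t"
  unfolding test_function_def
proof (intro conjI allI)
  have op: "open (- K)" using assms by (simp add: compact_imp_closed open_Compl)
  have un: "U \<union> - K = UNIV" using assms by auto
  have "continuous_on (- K) \<phi>r" "continuous_on (- K) \<phi>t"
    using 0 by (auto intro: continuous_on_eq[of _ "\<lambda>_. 0"])
  then show "continuous_on UNIV \<phi>r" "continuous_on UNIV \<phi>t"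
    using continuous_on_open_Un[OF assms(1) op] c unfolding un by blast+
  show "(\<phi> has_derivative (\<lambda>h. \<phi>r z * fst h + \<phi>t z * snd h)) (at z)" for z
  proof (cases "z \<in> U")
    case False
    then have z: "z \<notin> K" using assms by auto
    have "((\<lambda>_. 0::real) has_derivative (\<lambda>h. \<phi>r z * fst h + \<phi>t z * snd h)) (at z)"
      using 0[OF z] by simp
    then show ?thesis
      by (rule has_derivative_transform_within_open[OF _ op]) (use 0 z in auto)
  qed (rule d)
qed (use assms in auto)

lemma test_function_mult:
  assumes t: "test_function U \<phi> \<phi>r \<phi>t" and "open U"
    and d: "\<And>z. z \<in> U \<Longrightarrow> (c has_derivative (\<lambda>h. cr z * fst h + ct z * snd h)) (at z)"
    and c: "continuous_on U cr" "continuous_on U ct"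
  shows "test_function U (\<lambda>z. c z * \<phi> z) (\<lambda>z. cr z * \<phi> z + c z * \<phi>r z) (\<lambda>z. ct z * \<phi> z + c z * \<phi>t z)"
proof -
  obtain K where K: "compact K" "K \<subseteq> U" "\<And>z. z \<notin> K \<Longrightarrow> \<phi> z = 0 \<and> \<phi>r z = 0 \<and> \<phi>t z = 0"
    using test_function_support[OF t] by blast
  have d': "(\<phi> has_derivative (\<lambda>h. \<phi>r z * fst h + \<phi>t z * snd h)) (at z)" for z
    using t by (rule test_function_has_derivative)
  have "continuous_on U c" "continuous_on U \<phi>"
    using d d' has_derivative_continuous by (blast intro: continuous_at_imp_continuous_on)+
  moreover have "continuous_on U \<phi>r" "continuous_on U \<phi>t"
    using t by (auto simp: test_function_def intro: continuous_on_subset)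
  ultimately show ?thesis
    using c
    by (intro test_functionI[OF assms(2) K(1,2)])
       (auto intro!: continuous_intros derivative_eq_intros d d' simp: K algebra_simps)
qed

lemma test_function_diff:
  assumes "test_function U \<phi> \<phi>r \<phi>t" "test_function U \<eta> \<eta>r \<eta>t"
  shows "test_function U (\<lambda>z. \<phi> z - \<eta> z) (\<lambda>z. \<phi>r z - \<eta>r z) (\<lambda>z. \<phi>t z - \<eta>t z)"
proof -
  obtain K L where "compact K" "K \<subseteq> U" "\<And>z. z \<notin> K \<Longrightarrow> \<phi> z = 0"
    and "compact L" "L \<subseteq> U" "\<And>z. z \<notin> L \<Longrightarrow> \<eta> z = 0"
    using assms by (auto simp: test_function_def)
  then have "compact (K \<union> L)" "K \<union> L \<subseteq> U" "\<And>z. z \<notin> K \<union> L \<Longrightarrow> \<phi> z - \<eta> z = 0" by auto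
  moreover have "((\<lambda>z. \<phi> z - \<eta> z) has_derivative
      (\<lambda>h. (\<phi>r z - \<eta>r z) * fst h + (\<phi>t z - \<eta>t z) * snd h)) (at z)" for z
    using has_derivative_diff[OF assms[THEN test_function_has_derivative]]
    by (simp add: algebra_simps)
  ultimately show ?thesis
    using assms unfolding test_function_def by (auto intro!: continuous_intros exI[of _ "K \<union> L"])
qed

lemma test_function_restrict:
  assumes "test_function U \<phi> \<phi>r \<phi>t" "closed C" "\<And>z. z \<notin> C \<Longrightarrow> \<phi> z = 0" "U \<inter> C \<subseteq> U'"
  shows "test_function U' \<phi> \<phi>r \<phi>t"
proof -
  obtain K where "compact K" "K \<subseteq> U" "\<And>z. z \<notin> K \<Longrightarrow> \<phi> z = 0"
    using assms by (auto simp: test_function_def)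
  then have "compact (K \<inter> C) \<and> K \<inter> C \<subseteq> U' \<and> (\<forall>z. z \<notin> K \<inter> C \<longrightarrow> \<phi> z = 0)"
    using assms by (auto intro: compact_Int_closed)
  with assms(1) show ?thesis unfolding test_function_def by blast
qed

lemma test_function_continuous:
  assumes "test_function U \<phi> \<phi>r \<phi>t"
  shows "continuous_on A \<phi>" "continuous_on A \<phi>r" "continuous_on A \<phi>t"
  using assms has_derivative_continuous[OF test_function_has_derivative[OF assms]]
    continuous_on_subset[OF _ subset_UNIV] assms
  unfolding test_function_def
  by (blast intro: continuous_at_imp_continuous_on)+

section \<open>Integration by parts up to the initial line\<close>

text \<open>The supports of the test functions of the weak formulation. For \<open>t \<ge> 0\<close> this is the domain of
  the solution; negative times are added so that a test function need not vanish on the initial line.\<close>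

definition test_domain :: "real \<Rightarrow> real \<Rightarrow> (real \<times> real) set" where
  "test_domain R T = {(r, t). r > t + R \<and> r > R \<and> t < T}"

lemma open_test_domain: "open (test_domain R T)"
proof -
  have "test_domain R T = {z. fst z > snd z + R} \<inter> {z. fst z > R} \<inter> {z. snd z < T}"
    by (auto simp: test_domain_def)
  also have "open \<dots>"
    by (intro open_Int open_Collect_less continuous_intros)
  finally show ?thesis .
qed

lemma Theta_borel [measurable]: "Theta R T \<in> sets borel"
proof -
  have "Theta R T = {z. fst z > snd z + R} \<inter> {z. 0 \<le> snd z} \<inter> {z. snd z < T}"
    by (auto simp: Theta_def)
  also have "\<dots> \<in> sets borel"
    by (intro sets.Int borel_open borel_closed open_Collect_less closed_Collect_le continuous_intros)
  finally show ?thesis .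
qed

lemma Theta_pos_time_in_interior:
  assumes "z \<in> Theta R T" "snd z > 0"
  shows "z \<in> interior (Theta R T)"
proof -
  have "open ({z. fst z > snd z + R} \<inter> {z::real\<times>real. 0 < snd z} \<inter> {z. snd z < T})"
    by (intro open_Int open_Collect_less continuous_intros)
  then have "{z. fst z > snd z + R} \<inter> {z. 0 < snd z} \<inter> {z. snd z < T} \<subseteq> interior (Theta R T)"
    by (intro interior_maximal) (auto simp: Theta_def)
  with assms show ?thesis by (auto simp: Theta_def)
qed

lemma compact_test_domain_Int_Theta:
  assumes "compact K" "K \<subseteq> test_domain R T"
  shows "compact (K \<inter> {z. 0 \<le> snd z})" "K \<inter> {z. 0 \<le> snd z} \<subseteq> Theta R T"
    and "K \<inter> Theta R T \<subseteq> K \<inter> {z. 0 \<le> snd z}"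
  using assms
  by (auto simp: test_domain_def Theta_def intro!: compact_Int_closed closed_Collect_le continuous_intros)

lemma set_integrable_times_continuous:
  fixes v \<eta> :: "'a::euclidean_space \<Rightarrow> real"
  assumes K: "compact K" and v: "set_integrable lborel K v" and \<eta>: "continuous_on K \<eta>"
  shows "set_integrable lborel K (\<lambda>z. v z * \<eta> z)"
proof -
  have "bounded (\<eta> ` K)" using K \<eta> by (intro compact_imp_bounded compact_continuous_image)
  then obtain B where B: "\<And>z. z \<in> K \<Longrightarrow> \<bar>\<eta> z\<bar> \<le> B" by (auto simp: bounded_iff)
  have "(\<lambda>z. indicator K z * v z) \<in> borel_measurable lborel"
    using v by (auto simp: set_integrable_def dest: borel_measurable_integrable)
  moreover have "(\<lambda>z. indicator K z * \<eta> z) \<in> borel_measurable lborel"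
    using borel_measurable_continuous_on_indicator[of K \<eta>] K \<eta> by (simp add: compact_imp_closed)
  ultimately have m: "(\<lambda>z. (indicator K z * v z) * (indicator K z * \<eta> z)) \<in> borel_measurable lborel"
    by (rule borel_measurable_times)
  show ?thesis
  proof (rule set_integrable_bound)
    show "set_integrable lborel K (\<lambda>z. B * v z)" using v by simp
    have "(\<lambda>z. indicator K z *\<^sub>R (v z * \<eta> z)) = (\<lambda>z. (indicator K z * v z) * (indicator K z * \<eta> z))"
      by (auto simp: indicator_def)
    with m show "set_borel_measurable lborel K (\<lambda>z. v z * \<eta> z)"
      by (simp add: set_borel_measurable_def)
    have "\<bar>v z\<bar> * \<bar>\<eta> z\<bar> \<le> \<bar>B\<bar> * \<bar>v z\<bar>" if "z \<in> K" for z
      using mult_right_mono[of "\<bar>\<eta> z\<bar>" "\<bar>B\<bar>" "\<bar>v z\<bar>"] B[OF that] by (simp add: mult.commute)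
    then show "AE z in lborel. z \<in> K \<longrightarrow> norm (v z * \<eta> z) \<le> norm (B * v z)"
      by (auto simp: abs_mult)
  qed
qed

lemma set_integrable_extend_zero:
  assumes "set_integrable M K f" "K \<subseteq> S" "\<And>z. z \<in> S - K \<Longrightarrow> f z = 0"
  shows "set_integrable M S f"
proof -
  have "(\<lambda>z. indicator S z *\<^sub>R f z) = (\<lambda>z. indicator K z *\<^sub>R f z)"
    using assms by (force simp: indicator_def)
  with assms show ?thesis by (simp add: set_integrable_def)
qed

lemma set_integral_extend_zero:
  assumes "K \<subseteq> S" "\<And>z. z \<in> S - K \<Longrightarrow> f z = 0"
  shows "set_lebesgue_integral M K f = set_lebesgue_integral M S f"
proof -
  have "(\<lambda>z. indicator S z *\<^sub>R f z) = (\<lambda>z. indicator K z *\<^sub>R f z)"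
    using assms by (force simp: indicator_def)
  then show ?thesis by (simp add: set_lebesgue_integral_def)
qed

lemma set_integrable_compact:
  fixes f :: "'a::euclidean_space \<Rightarrow> real"
  shows "compact K \<Longrightarrow> continuous_on K f \<Longrightarrow> set_integrable lborel K f"
  unfolding set_integrable_def by (rule borel_integrable_compact)

text \<open>On a compact set the weight is bounded below by a positive constant, and \<open>f \<le> 1 + f^2\<close>; so locally
  finite energy implies local integrability.\<close>

lemma solution_class_integrable:
  assumes sol: "solution_class n R T u ur ut" and "n \<ge> 1" "R > 0"
    and K: "compact K" "K \<subseteq> Theta R T"
  shows "set_integrable lborel K u" "set_integrable lborel K ur" "set_integrable lborel K ut"
proof -
  define f where "f z = fst z powr ((real n - 1) / 2) * (\<bar>u z\<bar> + \<bar>ur z\<bar> + \<bar>ut z\<bar>)" for z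
  define c where "c = R powr ((real n - 1) / 2)"
  have c: "c > 0" using \<open>R > 0\<close> by (simp add: c_def)
  have Kb: "K \<in> sets lborel" using K by (auto simp: compact_imp_closed)
  have fin: "set_integrable lborel K (\<lambda>z. (1 + (f z)\<^sup>2) / c)"
  proof (intro set_integrable_divide set_integral_add(1))
    show "set_integrable lborel K (\<lambda>z. (f z)\<^sup>2)"
      using sol K by (auto simp: solution_class_def L2_loc_def f_def)
    show "set_integrable lborel K (\<lambda>z. 1::real)"
      using K by (intro set_integrable_compact continuous_intros)
  qed
  have "\<bar>u z\<bar> + \<bar>ur z\<bar> + \<bar>ut z\<bar> \<le> (1 + (f z)\<^sup>2) / c" if "z \<in> K" for z
  proof -
    have "R \<le> fst z" using that K by (auto simp: Theta_def)
    then have "c \<le> fst z powr ((real n - 1) / 2)"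
      unfolding c_def using \<open>n \<ge> 1\<close> \<open>R > 0\<close> by (intro powr_mono2) auto
    then have "c * (\<bar>u z\<bar> + \<bar>ur z\<bar> + \<bar>ut z\<bar>) \<le> f z"
      unfolding f_def by (intro mult_right_mono) auto
    also have "f z \<le> 1 + (f z)\<^sup>2"
      using zero_le_power2[of "f z - 1 / 2"] by (simp add: power2_eq_square algebra_simps)
    finally show ?thesis using c by (simp add: field_simps)
  qed
  then have bnd: "\<bar>u z\<bar> \<le> \<bar>(1 + (f z)\<^sup>2) / c\<bar> \<and> \<bar>ur z\<bar> \<le> \<bar>(1 + (f z)\<^sup>2) / c\<bar> \<and> \<bar>ut z\<bar> \<le> \<bar>(1 + (f z)\<^sup>2) / c\<bar>"
    if "z \<in> K" for z using that by (smt (verit))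
  have meas: "set_borel_measurable lborel K v" if "set_borel_measurable lborel (Theta R T) v" for v :: "real \<times> real \<Rightarrow> real"
    by (rule set_borel_measurable_subset[OF that]) (use Kb K in auto)
  show "set_integrable lborel K u"
    using sol K by (intro set_integrable_compact) (auto simp: solution_class_def intro: continuous_on_subset)
  show "set_integrable lborel K ur" "set_integrable lborel K ut"
    by (rule set_integrable_bound[OF fin meas]; use sol bnd in \<open>auto simp: solution_class_def\<close>)+
qed

lemma solution_class_integrable_times:
  assumes sol: "solution_class n R T u ur ut" and "n \<ge> 1" "R > 0"
    and K: "compact K" "K \<subseteq> test_domain R T" "\<And>z. z \<notin> K \<Longrightarrow> \<eta> z = 0" and \<eta>: "continuous_on UNIV \<eta>"
  shows "set_integrable lborel (Theta R T) (\<lambda>z. u z * \<eta> z)"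
    "set_integrable lborel (Theta R T) (\<lambda>z. ur z * \<eta> z)"
    "set_integrable lborel (Theta R T) (\<lambda>z. ut z * \<eta> z)"
proof -
  note K' = compact_test_domain_Int_Theta[OF K(1,2)]
  have *: "set_integrable lborel (Theta R T) (\<lambda>z. v z * \<eta> z)"
    if "set_integrable lborel (K \<inter> {z. 0 \<le> snd z}) v" for v
    by (rule set_integrable_extend_zero[OF set_integrable_times_continuous[OF K'(1) that] K'(2)])
       (use K' K \<eta> in \<open>auto intro: continuous_on_subset simp: Theta_def\<close>)
  show "set_integrable lborel (Theta R T) (\<lambda>z. u z * \<eta> z)"
    "set_integrable lborel (Theta R T) (\<lambda>z. ur z * \<eta> z)"
    "set_integrable lborel (Theta R T) (\<lambda>z. ut z * \<eta> z)"
    using solution_class_integrable[OF assms(1-3) K'(1,2)] * by blast+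
qed

lemma AE_snd_nonzero: "AE z::real\<times>real in lborel. snd z \<noteq> 0"
proof -
  have "{z::real\<times>real. snd z = 0} = UNIV \<times> {0}" by auto
  moreover have "emeasure (lborel \<Otimes>\<^sub>M lborel) ((UNIV::real set) \<times> {0::real}) = 0"
    by (subst lborel.emeasure_pair_measure_Times) auto
  ultimately have "emeasure lborel {z::real\<times>real. snd z = 0} = 0"
    by (simp add: lborel_prod)
  moreover have "closed {z::real\<times>real. snd z = 0}"
    by (intro closed_Collect_eq continuous_intros)
  ultimately have "{z::real\<times>real. snd z = 0} \<in> null_sets lborel"
    by (auto simp: null_sets_def)
  then show ?thesis by (rule AE_not_in[THEN AE_mp]) auto
qed

lemma measure_lborel_rectangle:
  fixes a b c d :: real
  assumes "a \<le> b" "c \<le> d"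
  shows "measure lborel (cbox (a, c) (b, d)) = (b - a) * (d - c)"
  using assms by (simp add: content_Pair)

text \<open>Vanishes for \<open>t \<le> 1 / (j + 1)\<close> and equals \<open>1\<close> for \<open>t \<ge> 2 / (j + 1)\<close>.\<close>

definition initial_cutoff :: "nat \<Rightarrow> real \<Rightarrow> real" where
  "initial_cutoff j t = smoothstep (real (Suc j) * t - 1)"

lemma initial_cutoff_tendsto:
  assumes "t > 0"
  shows "(\<lambda>j. initial_cutoff j t) \<longlonglongrightarrow> 1"
proof (rule tendsto_eventually)
  obtain N where N: "real N > 2 / t" using reals_Archimedean2 by blast
  have "initial_cutoff j t = 1" if "N \<le> j" for j
  proof -
    have "real N * t > 2" using N assms by (simp add: field_simps)
    moreover have "real (Suc j) * t \<ge> real N * t" using that assms by (intro mult_right_mono) auto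
    ultimately show ?thesis by (simp add: initial_cutoff_def smoothstep_right)
  qed
  then show "\<forall>\<^sub>F j in sequentially. initial_cutoff j t = 1"
    by (auto simp: eventually_sequentially)
qed

lemma set_integral_initial_cutoff:
  fixes f :: "real \<times> real \<Rightarrow> real"
  assumes f: "set_integrable lborel S f" and S: "\<And>z. z \<in> S \<Longrightarrow> 0 \<le> snd z"
  shows "(\<lambda>j. LINT z:S|lborel. initial_cutoff j (snd z) * f z) \<longlonglongrightarrow> (LINT z:S|lborel. f z)"
  unfolding set_lebesgue_integral_def
proof (rule integral_dominated_convergence)
  have fm: "(\<lambda>z. indicator S z *\<^sub>R f z) \<in> borel_measurable lborel"
    using f by (auto simp: set_integrable_def dest: borel_measurable_integrable)
  then show "(\<lambda>z. indicator S z *\<^sub>R f z) \<in> borel_measurable lborel" .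
  show "integrable lborel (\<lambda>z. norm (indicator S z *\<^sub>R f z))"
    using f by (auto simp: set_integrable_def)
  show "(\<lambda>z. indicator S z *\<^sub>R (initial_cutoff j (snd z) * f z)) \<in> borel_measurable lborel" for j
  proof -
    have "(\<lambda>z::real\<times>real. initial_cutoff j (snd z)) \<in> borel_measurable lborel"
      unfolding initial_cutoff_def
      by (simp, intro borel_measurable_continuous_onI continuous_on_compose2[OF continuous_smoothstep[of UNIV]]
           continuous_intros) auto
    moreover have "(\<lambda>z. indicator S z * f z) \<in> borel_measurable lborel"
      using fm by simp
    ultimately have "(\<lambda>z. initial_cutoff j (snd z) * (indicator S z * f z)) \<in> borel_measurable lborel"
      by (rule borel_measurable_times)
    then show ?thesis by (simp add: mult.left_commute)
  qed
  show "AE z in lborel. norm (indicator S z *\<^sub>R (initial_cutoff j (snd z) * f z)) \<le> norm (indicator S z *\<^sub>R f z)" for j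
    using smoothstep_bounds
    by (auto simp: initial_cutoff_def abs_mult indicator_def intro!: mult_left_le_one_le)
  show "AE z in lborel. (\<lambda>j. indicator S z *\<^sub>R (initial_cutoff j (snd z) * f z)) \<longlonglongrightarrow> indicator S z *\<^sub>R f z"
    using AE_snd_nonzero
  proof eventually_elim
    case (elim z)
    show ?case
    proof (cases "z \<in> S")
      case True
      then have "(\<lambda>j. initial_cutoff j (snd z) * f z) \<longlonglongrightarrow> 1 * f z"
        using elim S[of z] by (intro tendsto_intros initial_cutoff_tendsto) auto
      with True show ?thesis by simp
    qed simp
  qed
qed

text \<open>The derivative of the cut-off is of order \<open>j\<close> on a strip of height of order \<open>1 / j\<close>. In the limit only
  the initial values of \<open>v\<close> would be seen, and these are zero.\<close>

lemma initial_cutoff_derivative_term: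
  assumes v: "continuous_on (Theta R T) v" and K: "compact K" "K \<subseteq> Theta R T"
    and supp: "\<And>z. z \<in> Theta R T - K \<Longrightarrow> v z = 0" and init: "\<And>r. r > R \<Longrightarrow> v (r, 0) = 0" and "T > 0"
  shows "(\<lambda>j. LINT z:Theta R T|lborel. v z * (real (Suc j) * smoothstep_d1 (real (Suc j) * snd z - 1))) \<longlonglongrightarrow> 0"
proof (rule LIMSEQ_I)
  fix e :: real assume "e > 0"
  \<comment> \<open>The feet \<open>(r, 0)\<close> of the points of \<open>K\<close> are added so that uniform continuity compares \<open>v\<close> with its initial values.\<close>
  define L where "L = K \<union> (\<lambda>z. (fst z, 0)) ` K"
  have "compact ((\<lambda>z. (fst z, 0::real)) ` K)"
    using K by (intro compact_continuous_image continuous_intros)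
  then have L: "compact L" "L \<subseteq> Theta R T"
    using K \<open>T > 0\<close> by (auto simp: L_def Theta_def)
  then have uc: "uniformly_continuous_on L v"
    using v by (intro compact_uniformly_continuous continuous_on_subset[OF v])
  obtain a where "a > 0" "\<And>z. z \<in> K \<Longrightarrow> norm z \<le> a"
    using compact_imp_bounded[OF K(1)] unfolding bounded_pos by blast
  moreover have "\<bar>fst z\<bar> \<le> norm z" for z :: "real \<times> real"
    using norm_fst_le[of "fst z" "snd z"] by simp
  ultimately have a: "a > 0" "\<And>z. z \<in> K \<Longrightarrow> \<bar>fst z\<bar> \<le> a"
    by (blast intro: order_trans)+
  \<comment> \<open>The integrand will be at most \<open>30 * J * e'\<close> on a rectangle of area \<open>4 * a / J\<close>.\<close>
  define e' where "e' = e / (121 * a)"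
  have "e' > 0" using \<open>e > 0\<close> a by (simp add: e'_def)
  then obtain d where d: "d > 0" "\<And>x y. x \<in> L \<Longrightarrow> y \<in> L \<Longrightarrow> dist y x < d \<Longrightarrow> dist (v y) (v x) < e'"
    using uc unfolding uniformly_continuous_on_def by blast
  have small: "\<bar>v z\<bar> \<le> e'" if "z \<in> Theta R T" "snd z < d" for z
  proof (cases "z \<in> K")
    case True
    have "dist (v z) (v (fst z, 0)) < e'"
    proof (rule d(2))
      show "dist z (fst z, 0) < d"
        using that by (cases z) (auto simp: dist_Pair_Pair Theta_def dist_real_def)
    qed (use True in \<open>auto simp: L_def\<close>)
    moreover have "v (fst z, 0) = 0" using that by (intro init) (auto simp: Theta_def)
    ultimately show ?thesis by (simp add: dist_real_def)
  qed (use supp that \<open>e' > 0\<close> in auto)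
  obtain N where N: "real N > 2 / d" using reals_Archimedean2 by blast
  have "norm ((LINT z:Theta R T|lborel. v z * (real (Suc j) * smoothstep_d1 (real (Suc j) * snd z - 1))) - 0) < e"
    if "N \<le> j" for j
  proof -
    define J where "J = real (Suc j)"
    have J: "J > 0" "2 / J < d"
    proof -
      show "J > 0" by (simp add: J_def)
      have "2 < real N * d" using N d(1) by (simp add: field_simps)
      also have "real N * d \<le> J * d" using that d(1) by (intro mult_right_mono) (auto simp: J_def)
      finally show "2 / J < d" using \<open>J > 0\<close> by (simp add: field_simps)
    qed
    let ?C = "cbox (-a, 0) (a, 2 / J)"
    have C: "measure lborel ?C = 4 * a / J"
      using measure_lborel_rectangle[of "-a" a 0 "2/J"] a J by simp
    have pt: "norm (indicator (Theta R T) z *\<^sub>R (v z * (J * smoothstep_d1 (J * snd z - 1))))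
        \<le> indicator ?C z * (e' * (J * 30))" for z :: "real \<times> real"
    proof (cases "z \<in> Theta R T \<and> z \<in> K \<and> z \<in> ?C")
      case True
      then have z: "\<bar>v z\<bar> \<le> e'"
        using small[of z] J by (cases z) auto
      have "\<bar>v z\<bar> * (J * smoothstep_d1 (J * snd z - 1)) \<le> e' * (J * 30)"
        using z smoothstep_d1_bounds J \<open>e' > 0\<close> by (intro mult_mono) auto
      with True J smoothstep_d1_bounds(1)[of "J * snd z - 1"] show ?thesis by (simp add: abs_mult)
    next
      case False
      have "v z * (J * smoothstep_d1 (J * snd z - 1)) = 0" if z: "z \<in> Theta R T"
      proof (cases "z \<in> K")
        case True
        with False z have "z \<notin> ?C" by auto
        moreover have "- a \<le> fst z" "fst z \<le> a" "0 \<le> snd z"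
          using a(2)[OF True] z by (auto simp: Theta_def)
        ultimately have "snd z > 2 / J" by (cases z) auto
        then have "1 \<le> J * snd z - 1" using J by (simp add: field_simps)
        then show ?thesis by (simp add: smoothstep_right)
      qed (use supp z in auto)
      then show ?thesis using \<open>e' > 0\<close> J by (cases "z \<in> Theta R T") (auto simp: indicator_def)
    qed
    have "norm (LINT z:Theta R T|lborel. v z * (J * smoothstep_d1 (J * snd z - 1)))
      \<le> (LINT z|lborel. norm (indicator (Theta R T) z *\<^sub>R (v z * (J * smoothstep_d1 (J * snd z - 1)))))"
      unfolding set_lebesgue_integral_def by (rule integral_norm_bound)
    also have "\<dots> \<le> (LINT z|lborel. indicator ?C z * (e' * (J * 30)))"
    proof (rule integral_mono')
      show "integrable lborel (\<lambda>z. indicat_real ?C z * (e' * (J * 30)))"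
        using emeasure_lborel_cbox_finite by (intro integrable_mult_left integrable_real_indicator) auto
    qed (use pt \<open>e' > 0\<close> J in auto)
    also have "\<dots> = 120 * a * e'"
      using C J by simp
    also have "\<dots> < e" using a \<open>e > 0\<close> by (simp add: e'_def)
    finally show ?thesis by (simp add: J_def)
  qed
  then show "\<exists>no. \<forall>j\<ge>no. norm ((LINT z:Theta R T|lborel. v z * (real (Suc j) * smoothstep_d1 (real (Suc j) * snd z - 1))) - 0) < e"
    by blast
qed

lemma has_derivative_affine_comp:
  fixes f :: "real \<Rightarrow> real"
  assumes "(f has_real_derivative f') (at (a * fst z + b * snd z + c))"
  shows "((\<lambda>z::real\<times>real. f (a * fst z + b * snd z + c)) has_derivative
    (\<lambda>h. (a * f') * fst h + (b * f') * snd h)) (at z)"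
proof -
  have "((\<lambda>z::real\<times>real. a * fst z + b * snd z + c) has_derivative (\<lambda>h. a * fst h + b * snd h)) (at z)"
    by (auto intro!: derivative_eq_intros)
  from has_derivative_compose[OF this assms[unfolded has_field_derivative_def]]
  show ?thesis by (simp add: algebra_simps)
qed

text \<open>The weak derivatives are defined by test functions that vanish near \<open>t = 0\<close>. Multiplying by the
  cut-off in time makes a general test function admissible, and the additional term, which
  contains the derivative of the cut-off, disappears in the limit because \<open>u = 0\<close> initially.\<close>

lemma weak_partials_up_to_initial_time:
  assumes sol: "solution_class n R T u ur ut" and n: "n \<ge> 1" and R: "R > 0" and "T > 0"
    and init: "\<And>r. r > R \<Longrightarrow> u (r, 0) = 0"
    and test: "test_function (test_domain R T) \<eta> \<eta>r \<eta>t"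
  shows "(LINT z:Theta R T|lborel. u z * \<eta>r z) = - (LINT z:Theta R T|lborel. ur z * \<eta> z)"
    and "(LINT z:Theta R T|lborel. u z * \<eta>t z) = - (LINT z:Theta R T|lborel. ut z * \<eta> z)"
proof -
  obtain K where K: "compact K" "K \<subseteq> test_domain R T"
    and K0: "\<And>z. z \<notin> K \<Longrightarrow> \<eta> z = 0 \<and> \<eta>r z = 0 \<and> \<eta>t z = 0"
    using test_function_support[OF test] by blast
  note K' = compact_test_domain_Int_Theta[OF K]
  note cont = test_function_continuous[OF test]
  note int = solution_class_integrable_times[OF sol n R K _ cont(1)]
    solution_class_integrable_times[OF sol n R K _ cont(2)]
    solution_class_integrable_times[OF sol n R K _ cont(3)]
  have Theta0: "\<And>z. z \<in> Theta R T \<Longrightarrow> 0 \<le> snd z" by (auto simp: Theta_def)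
  have usubset: "interior (Theta R T) \<subseteq> Theta R T" by (rule interior_subset)
  define c where "c j z = initial_cutoff j (snd z)" for j and z :: "real \<times> real"
  define ct where "ct j z = real (Suc j) * smoothstep_d1 (real (Suc j) * snd z - 1)" for j and z :: "real \<times> real"
  have c0: "c j z = 0" "ct j z = 0" if "real (Suc j) * snd z \<le> 1" for j z
    using that by (auto simp: c_def ct_def initial_cutoff_def smoothstep_left)
  have bdry: "c j z = 0 \<and> ct j z = 0" if "z \<in> Theta R T - interior (Theta R T)" for j z
    using Theta_pos_time_in_interior[of z R T] Theta0[of z] that by (intro conjI c0; force)
  have tf: "test_function (interior (Theta R T)) (\<lambda>z. c j z * \<eta> z)
      (\<lambda>z. 0 * \<eta> z + c j z * \<eta>r z) (\<lambda>z. ct j z * \<eta> z + c j z * \<eta>t z)" for j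
  proof (rule test_function_restrict)
    show "test_function (test_domain R T) (\<lambda>z. c j z * \<eta> z)
      (\<lambda>z. 0 * \<eta> z + c j z * \<eta>r z) (\<lambda>z. ct j z * \<eta> z + c j z * \<eta>t z)"
    proof (rule test_function_mult[OF test open_test_domain])
      show "(c j has_derivative (\<lambda>h. 0 * fst h + ct j z * snd h)) (at z)" for z
        using has_derivative_affine_comp[where a=0 and b="real (Suc j)" and c="-1" and z=z, OF DERIV_smoothstep]
        by (simp add: c_def[abs_def] ct_def initial_cutoff_def)
      show "continuous_on (test_domain R T) (ct j)"
        unfolding ct_def by (intro continuous_intros continuous_on_compose2[OF continuous_smoothstep_d1[of UNIV]]) auto
    qed auto
    show "closed {z::real\<times>real. 1 \<le> real (Suc j) * snd z}"
      by (intro closed_Collect_le continuous_intros)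
    show "test_domain R T \<inter> {z. 1 \<le> real (Suc j) * snd z} \<subseteq> interior (Theta R T)"
    proof
      fix z assume z: "z \<in> test_domain R T \<inter> {z. 1 \<le> real (Suc j) * snd z}"
      then have "0 < real (Suc j) * snd z" by simp
      then have "snd z > 0" by (simp add: zero_less_mult_iff)
      with z show "z \<in> interior (Theta R T)"
        by (intro Theta_pos_time_in_interior) (auto simp: test_domain_def Theta_def)
    qed
  qed (use c0 in auto)
  have wp: "(LINT z:Theta R T|lborel. u z * (c j z * \<eta>r z)) = - (LINT z:Theta R T|lborel. ur z * (c j z * \<eta> z))"
    "(LINT z:Theta R T|lborel. u z * (ct j z * \<eta> z + c j z * \<eta>t z)) = - (LINT z:Theta R T|lborel. ut z * (c j z * \<eta> z))" for j
  proof -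
    have w: "weak_partials (interior (Theta R T)) u ur ut"
      using sol by (simp add: solution_class_def)
    have ext: "(LINT z:interior (Theta R T)|lborel. f z) = (LINT z:Theta R T|lborel. f z)"
      if "\<And>z. z \<in> Theta R T - interior (Theta R T) \<Longrightarrow> f z = 0" for f :: "real \<times> real \<Rightarrow> real"
      by (rule set_integral_extend_zero[OF usubset that])
    show "(LINT z:Theta R T|lborel. u z * (c j z * \<eta>r z)) = - (LINT z:Theta R T|lborel. ur z * (c j z * \<eta> z))"
      using w[unfolded weak_partials_def, rule_format, OF tf[of j], THEN conjunct1] bdry[of _ j]
      by (subst (1 2) ext[symmetric]) auto
    show "(LINT z:Theta R T|lborel. u z * (ct j z * \<eta> z + c j z * \<eta>t z)) = - (LINT z:Theta R T|lborel. ut z * (c j z * \<eta> z))"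
      using w[unfolded weak_partials_def, rule_format, OF tf[of j], THEN conjunct2] bdry[of _ j]
      by (subst (1 2) ext[symmetric]) auto
  qed
  have lim: "(\<lambda>j. LINT z:Theta R T|lborel. v z * (c j z * h z)) \<longlonglongrightarrow> (LINT z:Theta R T|lborel. v z * h z)"
    if "set_integrable lborel (Theta R T) (\<lambda>z. v z * h z)" for v h :: "real \<times> real \<Rightarrow> real"
    using set_integral_initial_cutoff[OF that Theta0] by (simp add: c_def mult.left_commute)
  have "(\<lambda>j. LINT z:Theta R T|lborel. u z * (c j z * \<eta>r z)) \<longlonglongrightarrow> - (LINT z:Theta R T|lborel. ur z * \<eta> z)"
    unfolding wp using lim[OF int(2)] K0 by (intro tendsto_minus) auto
  then show "(LINT z:Theta R T|lborel. u z * \<eta>r z) = - (LINT z:Theta R T|lborel. ur z * \<eta> z)"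
    using lim[OF int(4)] K0 LIMSEQ_unique by blast
  have "(\<lambda>j. LINT z:Theta R T|lborel. (u z * \<eta> z) * ct j z) \<longlonglongrightarrow> 0"
    unfolding ct_def
  proof (rule initial_cutoff_derivative_term[OF _ K'(1,2)])
    show "continuous_on (Theta R T) (\<lambda>z. u z * \<eta> z)"
      using sol cont by (intro continuous_intros) (auto simp: solution_class_def)
  qed (use K0 init \<open>T > 0\<close> K' in \<open>auto simp: Theta_def\<close>)
  moreover have "(\<lambda>j. LINT z:Theta R T|lborel. u z * (c j z * \<eta>t z)) \<longlonglongrightarrow> (LINT z:Theta R T|lborel. u z * \<eta>t z)"
    using lim[OF int(7)] K0 by auto
  ultimately have "(\<lambda>j. (LINT z:Theta R T|lborel. (u z * \<eta> z) * ct j z) + (LINT z:Theta R T|lborel. u z * (c j z * \<eta>t z)))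
     \<longlonglongrightarrow> 0 + (LINT z:Theta R T|lborel. u z * \<eta>t z)"
    by (rule tendsto_add)
  moreover have "(LINT z:Theta R T|lborel. (u z * \<eta> z) * ct j z) + (LINT z:Theta R T|lborel. u z * (c j z * \<eta>t z))
    = (LINT z:Theta R T|lborel. u z * (ct j z * \<eta> z + c j z * \<eta>t z))" for j
  proof -
    have cc: "continuous_on UNIV (c j)" "continuous_on UNIV (ct j)"
      unfolding c_def[abs_def] ct_def[abs_def] initial_cutoff_def
      by (intro continuous_intros continuous_on_compose2[OF continuous_smoothstep_d1[of UNIV]]
          continuous_on_compose2[OF continuous_smoothstep[of UNIV]]; auto)+
    have "set_integrable lborel (Theta R T) (\<lambda>z. u z * (\<eta> z * ct j z))"
      "set_integrable lborel (Theta R T) (\<lambda>z. u z * (c j z * \<eta>t z))"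
      using K0 cc cont by (auto intro!: solution_class_integrable_times(1)[OF sol n R K] continuous_intros)
    from set_integral_add(2)[OF this] show ?thesis by (simp add: algebra_simps)
  qed
  ultimately have "(\<lambda>j. - (LINT z:Theta R T|lborel. ut z * (c j z * \<eta> z))) \<longlonglongrightarrow> (LINT z:Theta R T|lborel. u z * \<eta>t z)"
    by (simp add: wp)
  moreover have "(\<lambda>j. - (LINT z:Theta R T|lborel. ut z * (c j z * \<eta> z))) \<longlonglongrightarrow> - (LINT z:Theta R T|lborel. ut z * \<eta> z)"
    using lim[OF int(3)] K0 by (intro tendsto_minus) auto
  ultimately show "(LINT z:Theta R T|lborel. u z * \<eta>t z) = - (LINT z:Theta R T|lborel. ut z * \<eta> z)"
    using LIMSEQ_unique by blast
qed

lemma test_function_add: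
  assumes "test_function U \<phi> \<phi>r \<phi>t" "test_function U \<eta> \<eta>r \<eta>t"
  shows "test_function U (\<lambda>z. \<phi> z + \<eta> z) (\<lambda>z. \<phi>r z + \<eta>r z) (\<lambda>z. \<phi>t z + \<eta>t z)"
  using test_function_diff[OF assms(1) test_function_diff[OF test_function_diff[OF assms(2,2)] assms(2)]]
  by simp

section \<open>The wave equation with all derivatives on the test function\<close>

lemma has_derivative_radial_powr:
  assumes "fst z > 0"
  shows "((\<lambda>z::real\<times>real. a * fst z powr e) has_derivative
    (\<lambda>h. a * (e * fst z powr (e - 1)) * fst h + 0 * snd h)) (at z)"
proof -
  have "((\<lambda>x. a * x powr e) has_real_derivative a * (e * fst z powr (e - 1))) (at (1 * fst z + 0 * snd z + 0))"
    using has_real_derivative_powr[of "fst z" e] assms by (auto intro!: derivative_eq_intros)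
  from has_derivative_affine_comp[OF this] show ?thesis by simp
qed

lemma continuous_on_radial_powr:
  assumes "R > 0" "\<And>z. z \<in> U \<Longrightarrow> fst z > R"
  shows "continuous_on U (\<lambda>z::real\<times>real. fst z powr e)"
proof -
  have "fst z \<noteq> 0" if "z \<in> U" for z using assms(1) assms(2)[OF that] by simp
  then show ?thesis by (intro continuous_intros) auto
qed

text \<open>The weak formulation is applied to \<open>\<phi> = r powr (- m) * \<eta>\<close>, and the derivatives of \<open>u\<close> are then moved
  to the test functions \<open>r powr (n - 1) * \<phi>r\<close> and \<open>r powr (n - 1) * \<phi>t\<close>. Since \<open>n - 1 = 2 m\<close>, the
  first-order terms in \<open>\<eta>\<close> cancel, and only the potential \<open>m (m - 1) / r^2\<close> remains of the dimension.\<close>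

lemma very_weak_wave_equation:
  fixes n :: nat
  defines "m \<equiv> (real n - 1) / 2"
  assumes sol: "solution_class n R T u ur ut" and init: "\<And>r. r > R \<Longrightarrow> u (r, 0) = 0"
    and eq: "\<And>\<phi> \<phi>r \<phi>t. test_function (test_domain R T) \<phi> \<phi>r \<phi>t \<Longrightarrow>
        (LINT z:Theta R T|lborel. fst z ^ (n - 1) * (ur z * \<phi>r z - ut z * \<phi>t z - g (fst z) (u z) * \<phi> z))
      = (LINT r:{R<..}|lborel. r ^ (n - 1) * \<psi> r * \<phi> (r, 0))"
    and n: "n \<ge> 1" and R: "R > 0" and T: "T > 0"
    and g: "continuous_on ({R<..} \<times> UNIV) (\<lambda>(r, v). g r v)"
    and tf: "test_function (test_domain R T) \<eta> \<eta>r \<eta>t"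
    and tr: "test_function (test_domain R T) \<eta>r \<eta>rr \<eta>rt"
    and tt: "test_function (test_domain R T) \<eta>t \<eta>tr \<eta>tt"
  shows "(LINT z:Theta R T|lborel. fst z powr m * u z * (\<eta>tt z - \<eta>rr z + m * (m - 1) / (fst z)\<^sup>2 * \<eta> z))
    = (LINT z:Theta R T|lborel. fst z powr m * g (fst z) (u z) * \<eta> z)
      + (LINT r:{R<..}|lborel. r powr m * \<psi> r * \<eta> (r, 0))"
proof -
  note op = open_test_domain[of R T]
  have Rpos: "fst z > R" "fst z > 0" if "z \<in> test_domain R T" for z
    using that R by (auto simp: test_domain_def)
  have RTh: "fst z > R" "fst z > 0" if "z \<in> Theta R T" for z
    using that R by (auto simp: Theta_def)
  have pw: "fst z ^ (n - 1) = fst z powr (2 * m)" "r ^ (n - 1) = r powr (2 * m)"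
    if "z \<in> Theta R T" "r > R" for z r
  proof -
    have "2 * m = real (n - 1)" using n by (simp add: m_def of_nat_diff)
    then show "fst z ^ (n - 1) = fst z powr (2 * m)" "r ^ (n - 1) = r powr (2 * m)"
      using RTh(2)[OF that(1)] R that by (simp_all add: powr_realpow)
  qed
  note mult = test_function_mult[OF _ op has_derivative_radial_powr[OF Rpos(2)]]
  note cont = continuous_on_radial_powr[where U = "test_domain R T", OF R Rpos(1)]
  have phi: "test_function (test_domain R T) (\<lambda>z. 1 * fst z powr (- m) * \<eta> z)
     (\<lambda>z. 1 * (- m * fst z powr (- m - 1)) * \<eta> z + 1 * fst z powr (- m) * \<eta>r z)
     (\<lambda>z. 0 * \<eta> z + 1 * fst z powr (- m) * \<eta>t z)"
    by (rule mult[OF tf]) (auto intro!: continuous_on_mult continuous_on_minus continuous_on_const cont)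
  have r1: "test_function (test_domain R T) (\<lambda>z. 1 * fst z powr m * \<eta>r z)
     (\<lambda>z. 1 * (m * fst z powr (m - 1)) * \<eta>r z + 1 * fst z powr m * \<eta>rr z)
     (\<lambda>z. 0 * \<eta>r z + 1 * fst z powr m * \<eta>rt z)"
    by (rule mult[OF tr]) (auto intro!: continuous_on_mult continuous_on_minus continuous_on_const cont)
  have r2: "test_function (test_domain R T) (\<lambda>z. m * fst z powr (m - 1) * \<eta> z)
     (\<lambda>z. m * ((m - 1) * fst z powr (m - 1 - 1)) * \<eta> z + m * fst z powr (m - 1) * \<eta>r z)
     (\<lambda>z. 0 * \<eta> z + m * fst z powr (m - 1) * \<eta>t z)"
    by (rule mult[OF tf]) (auto intro!: continuous_on_mult continuous_on_minus continuous_on_const cont)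
  have t1: "test_function (test_domain R T) (\<lambda>z. 1 * fst z powr m * \<eta>t z)
     (\<lambda>z. 1 * (m * fst z powr (m - 1)) * \<eta>t z + 1 * fst z powr m * \<eta>tr z)
     (\<lambda>z. 0 * \<eta>t z + 1 * fst z powr m * \<eta>tt z)"
    by (rule mult[OF tt]) (auto intro!: continuous_on_mult continuous_on_minus continuous_on_const cont)
  note r = test_function_diff[OF r1 r2]
  \<comment> \<open>The products of \<open>r ^ (n - 1)\<close> with the two partial derivatives of \<open>r powr (- m) * \<eta>\<close>, followed by the partial derivatives of these products that enter the integration by parts.\<close>
  define \<eta>1 where "\<eta>1 = (\<lambda>z. 1 * fst z powr m * \<eta>r z - m * fst z powr (m - 1) * \<eta> z)"
  define \<eta>1r where "\<eta>1r = (\<lambda>z. 1 * (m * fst z powr (m - 1)) * \<eta>r z + 1 * fst z powr m * \<eta>rr z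
     - (m * ((m - 1) * fst z powr (m - 1 - 1)) * \<eta> z + m * fst z powr (m - 1) * \<eta>r z))"
  define \<eta>2 where "\<eta>2 = (\<lambda>z. 1 * fst z powr m * \<eta>t z)"
  define \<eta>2t where "\<eta>2t = (\<lambda>z. 0 * \<eta>t z + 1 * fst z powr m * \<eta>tt z)"
  note r' = r[folded \<eta>1_def \<eta>1r_def] and t' = t1[folded \<eta>2_def \<eta>2t_def]
  have parts: "(LINT z:Theta R T|lborel. u z * \<eta>1r z) = - (LINT z:Theta R T|lborel. ur z * \<eta>1 z)"
    "(LINT z:Theta R T|lborel. u z * \<eta>2t z) = - (LINT z:Theta R T|lborel. ut z * \<eta>2 z)"
    using weak_partials_up_to_initial_time[OF sol n R T init] r' t' by blast+
  have int_times: "set_integrable lborel (Theta R T) (\<lambda>z. u z * \<phi> z)"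
      "set_integrable lborel (Theta R T) (\<lambda>z. ur z * \<phi> z)"
      "set_integrable lborel (Theta R T) (\<lambda>z. ut z * \<phi> z)"
      "set_integrable lborel (Theta R T) (\<lambda>z. u z * \<phi>r z)"
      "set_integrable lborel (Theta R T) (\<lambda>z. u z * \<phi>t z)"
    if test: "test_function (test_domain R T) \<phi> \<phi>r \<phi>t" for \<phi> \<phi>r \<phi>t
  proof -
    obtain K where K: "compact K" "K \<subseteq> test_domain R T"
      and K0: "\<And>z. z \<notin> K \<Longrightarrow> \<phi> z = 0 \<and> \<phi>r z = 0 \<and> \<phi>t z = 0"
      using test_function_support[OF test] by blast
    note c = test_function_continuous[OF test]
    show "set_integrable lborel (Theta R T) (\<lambda>z. u z * \<phi> z)"
      "set_integrable lborel (Theta R T) (\<lambda>z. ur z * \<phi> z)"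
      "set_integrable lborel (Theta R T) (\<lambda>z. ut z * \<phi> z)"
      "set_integrable lborel (Theta R T) (\<lambda>z. u z * \<phi>r z)"
      "set_integrable lborel (Theta R T) (\<lambda>z. u z * \<phi>t z)"
      using solution_class_integrable_times[OF sol n R K _ c(1)]
        solution_class_integrable_times(1)[OF sol n R K _ c(2)]
        solution_class_integrable_times(1)[OF sol n R K _ c(3)] K0 by blast+
  qed
  have uc: "continuous_on (Theta R T) u" using sol by (simp add: solution_class_def)
  have gc: "continuous_on (Theta R T) (\<lambda>z. g (fst z) (u z))"
  proof -
    have "continuous_on (Theta R T) (\<lambda>z. (fst z, u z))"
      by (intro continuous_intros uc)
    moreover have "(\<lambda>z. (fst z, u z)) ` Theta R T \<subseteq> {R<..} \<times> UNIV"
      using RTh by auto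
    ultimately show ?thesis
      using continuous_on_compose2[OF g, of "Theta R T" "\<lambda>z. (fst z, u z)"] by simp
  qed
  have int_g: "set_integrable lborel (Theta R T) (\<lambda>z. fst z powr m * g (fst z) (u z) * \<eta> z)"
  proof -
    obtain K where K: "compact K" "K \<subseteq> test_domain R T"
      and K0: "\<And>z. z \<notin> K \<Longrightarrow> \<eta> z = 0 \<and> \<eta>r z = 0 \<and> \<eta>t z = 0"
      using test_function_support[OF tf] by blast
    note K' = compact_test_domain_Int_Theta[OF K]
    have "continuous_on (Theta R T) (\<lambda>z. fst z powr m * g (fst z) (u z) * \<eta> z)"
      by (intro continuous_on_mult gc test_function_continuous[OF tf] continuous_on_radial_powr[OF R RTh(1)])
    then show ?thesis
      by (intro set_integrable_extend_zero[OF set_integrable_compact K'(2)] K'(1))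
         (use K' K0 in \<open>auto intro: continuous_on_subset simp: Theta_def\<close>)
  qed
  have "(LINT r:{R<..}|lborel. r powr m * \<psi> r * \<eta> (r, 0))
    = (LINT r:{R<..}|lborel. r ^ (n - 1) * \<psi> r * (1 * fst (r, 0::real) powr (- m) * \<eta> (r, 0)))"
  proof (rule set_lebesgue_integral_cong)
    show "\<forall>r. r \<in> {R<..} \<longrightarrow> r powr m * \<psi> r * \<eta> (r, 0)
      = r ^ (n - 1) * \<psi> r * (1 * fst (r, 0::real) powr (- m) * \<eta> (r, 0))"
    proof (intro allI impI)
      fix r assume "r \<in> {R<..}"
      then have "r > R" by simp
      have "(r, 0) \<in> Theta R T" using \<open>r > R\<close> T by (auto simp: Theta_def)
      have "r powr m = r ^ (n - 1) * r powr (- m)"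
        unfolding pw(2)[OF \<open>(r, 0) \<in> Theta R T\<close> \<open>r > R\<close>] by (simp flip: powr_add)
      then show "r powr m * \<psi> r * \<eta> (r, 0)
        = r ^ (n - 1) * \<psi> r * (1 * fst (r, 0::real) powr (- m) * \<eta> (r, 0))" by simp
    qed
  qed simp
  also have "\<dots> = (LINT z:Theta R T|lborel. fst z ^ (n - 1) *
      (ur z * (1 * (- m * fst z powr (- m - 1)) * \<eta> z + 1 * fst z powr (- m) * \<eta>r z)
       - ut z * (0 * \<eta> z + 1 * fst z powr (- m) * \<eta>t z)
       - g (fst z) (u z) * (1 * fst z powr (- m) * \<eta> z)))"
    by (rule eq[OF phi, symmetric])
  also have "\<dots> = (LINT z:Theta R T|lborel. ur z * \<eta>1 z - ut z * \<eta>2 z - fst z powr m * g (fst z) (u z) * \<eta> z)"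
  proof (rule set_lebesgue_integral_cong)
    show "\<forall>z. z \<in> Theta R T \<longrightarrow> fst z ^ (n - 1) *
      (ur z * (1 * (- m * fst z powr (- m - 1)) * \<eta> z + 1 * fst z powr (- m) * \<eta>r z)
       - ut z * (0 * \<eta> z + 1 * fst z powr (- m) * \<eta>t z)
       - g (fst z) (u z) * (1 * fst z powr (- m) * \<eta> z))
      = ur z * \<eta>1 z - ut z * \<eta>2 z - fst z powr m * g (fst z) (u z) * \<eta> z"
    proof (intro allI impI)
      fix z assume z: "z \<in> Theta R T"
      define P where "P = fst z ^ (n - 1)"
      have 1: "fst z powr m = P * fst z powr (- m)"
        unfolding P_def pw(1)[OF z RTh(1)[OF z]] by (simp flip: powr_add)
      have 2: "fst z powr (m - 1) = P * fst z powr (- m - 1)"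
        unfolding P_def pw(1)[OF z RTh(1)[OF z]] by (simp flip: powr_add)
      show "fst z ^ (n - 1) *
      (ur z * (1 * (- m * fst z powr (- m - 1)) * \<eta> z + 1 * fst z powr (- m) * \<eta>r z)
       - ut z * (0 * \<eta> z + 1 * fst z powr (- m) * \<eta>t z)
       - g (fst z) (u z) * (1 * fst z powr (- m) * \<eta> z))
      = ur z * \<eta>1 z - ut z * \<eta>2 z - fst z powr m * g (fst z) (u z) * \<eta> z"
        unfolding \<eta>1_def \<eta>2_def 1 2 P_def[symmetric] by (simp add: algebra_simps)
    qed
  qed simp
  also have "\<dots> = (LINT z:Theta R T|lborel. ur z * \<eta>1 z) - (LINT z:Theta R T|lborel. ut z * \<eta>2 z)
    - (LINT z:Theta R T|lborel. fst z powr m * g (fst z) (u z) * \<eta> z)"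
    using int_times[OF r'] int_times[OF t'] int_g by simp
  also have "(LINT z:Theta R T|lborel. ur z * \<eta>1 z) - (LINT z:Theta R T|lborel. ut z * \<eta>2 z)
    = (LINT z:Theta R T|lborel. u z * \<eta>2t z) - (LINT z:Theta R T|lborel. u z * \<eta>1r z)"
    using parts by simp
  also have "\<dots> = (LINT z:Theta R T|lborel. u z * \<eta>2t z - u z * \<eta>1r z)"
    using int_times[OF r'] int_times[OF t'] by simp
  also have "\<dots> = (LINT z:Theta R T|lborel. fst z powr m * u z * (\<eta>tt z - \<eta>rr z + m * (m - 1) / (fst z)\<^sup>2 * \<eta> z))"
  proof (rule set_lebesgue_integral_cong)
    show "\<forall>z. z \<in> Theta R T \<longrightarrow> u z * \<eta>2t z - u z * \<eta>1r z
      = fst z powr m * u z * (\<eta>tt z - \<eta>rr z + m * (m - 1) / (fst z)\<^sup>2 * \<eta> z)"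
    proof (intro allI impI)
      fix z assume z: "z \<in> Theta R T"
      have "fst z powr (m - 1 - 1) = fst z powr (m - 2)" by simp
      also have "\<dots> = fst z powr m / (fst z)\<^sup>2"
        using RTh(2)[OF z] by (simp add: powr_diff powr_realpow)
      finally have 1: "fst z powr (m - 1 - 1) = fst z powr m / (fst z)\<^sup>2" .
      show "u z * \<eta>2t z - u z * \<eta>1r z
        = fst z powr m * u z * (\<eta>tt z - \<eta>rr z + m * (m - 1) / (fst z)\<^sup>2 * \<eta> z)"
        unfolding \<eta>2t_def \<eta>1r_def 1 by (simp add: algebra_simps)
    qed
  qed simp
  finally show ?thesis by simp
qed

section \<open>Products in null coordinates\<close>

lemma test_function_null_product:
  assumes f: "\<And>x. (f has_real_derivative f1 x) (at x)" "continuous_on UNIV f1" "\<And>x. x \<ge> b \<Longrightarrow> f x = 0"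
    and h: "\<And>x. (h has_real_derivative h1 x) (at x)" "continuous_on UNIV h1" "\<And>x. x \<ge> c \<Longrightarrow> h x = 0"
    and k: "\<And>x. (k has_real_derivative k1 x) (at x)" "continuous_on UNIV k1" "\<And>x. x \<le> - s \<Longrightarrow> k x = 0"
    and s: "R < - c - s" "s > 0" "b + c < 2 * T"
  shows "test_function (test_domain R T)
    (\<lambda>z. f (fst z + snd z) * h (snd z - fst z) * k (snd z))
    (\<lambda>z. f1 (fst z + snd z) * h (snd z - fst z) * k (snd z) - f (fst z + snd z) * h1 (snd z - fst z) * k (snd z))
    (\<lambda>z. f1 (fst z + snd z) * h (snd z - fst z) * k (snd z) + f (fst z + snd z) * h1 (snd z - fst z) * k (snd z)
        + f (fst z + snd z) * h (snd z - fst z) * k1 (snd z))"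
  unfolding test_function_def
proof (intro conjI allI)
  have cf: "continuous_on UNIV f" "continuous_on UNIV h" "continuous_on UNIV k"
    using f h k by (auto intro!: continuous_at_imp_continuous_on DERIV_isCont)
  note cc = continuous_on_compose2[OF cf(1)] continuous_on_compose2[OF cf(2)] continuous_on_compose2[OF cf(3)]
    continuous_on_compose2[OF f(2)] continuous_on_compose2[OF h(2)] continuous_on_compose2[OF k(2)]
  show "continuous_on UNIV (\<lambda>z::real\<times>real. f1 (fst z + snd z) * h (snd z - fst z) * k (snd z) - f (fst z + snd z) * h1 (snd z - fst z) * k (snd z))"
    by (intro continuous_intros cc) auto
  show "continuous_on UNIV (\<lambda>z::real\<times>real. f1 (fst z + snd z) * h (snd z - fst z) * k (snd z) + f (fst z + snd z) * h1 (snd z - fst z) * k (snd z)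
        + f (fst z + snd z) * h (snd z - fst z) * k1 (snd z))"
    by (intro continuous_intros cc) auto
  fix z :: "real \<times> real"
  have d: "((\<lambda>z. f (1 * fst z + 1 * snd z + 0)) has_derivative
      (\<lambda>v. (1 * f1 (1 * fst z + 1 * snd z + 0)) * fst v + (1 * f1 (1 * fst z + 1 * snd z + 0)) * snd v)) (at z)"
    "((\<lambda>z. h ((-1) * fst z + 1 * snd z + 0)) has_derivative
      (\<lambda>v. ((-1) * h1 ((-1) * fst z + 1 * snd z + 0)) * fst v + (1 * h1 ((-1) * fst z + 1 * snd z + 0)) * snd v)) (at z)"
    "((\<lambda>z. k (0 * fst z + 1 * snd z + 0)) has_derivative
      (\<lambda>v. (0 * k1 (0 * fst z + 1 * snd z + 0)) * fst v + (1 * k1 (0 * fst z + 1 * snd z + 0)) * snd v)) (at z)"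
    by (intro has_derivative_affine_comp f h k)+
  show "((\<lambda>z. f (fst z + snd z) * h (snd z - fst z) * k (snd z)) has_derivative
    (\<lambda>v. (f1 (fst z + snd z) * h (snd z - fst z) * k (snd z) - f (fst z + snd z) * h1 (snd z - fst z) * k (snd z)) * fst v
     + (f1 (fst z + snd z) * h (snd z - fst z) * k (snd z) + f (fst z + snd z) * h1 (snd z - fst z) * k (snd z)
        + f (fst z + snd z) * h (snd z - fst z) * k1 (snd z)) * snd v)) (at z)"
    using has_derivative_mult[OF has_derivative_mult[OF d(1,2)] d(3)]
    by (simp add: algebra_simps)
next
  define K where "K = {z::real\<times>real. fst z + snd z \<le> b} \<inter> {z. snd z - fst z \<le> c} \<inter> {z. - s \<le> snd z}"
  have "closed K" unfolding K_def by (intro closed_Int closed_Collect_le continuous_intros)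
  moreover have "K \<subseteq> cbox (- c - s, - s) (b + s, (b + c) / 2)" by (auto simp: K_def)
  then have "bounded K" by (rule bounded_subset[OF bounded_cbox])
  ultimately have "compact K" by (simp add: compact_eq_bounded_closed)
  moreover have "K \<subseteq> test_domain R T" using s by (auto simp: K_def test_domain_def)
  moreover have "f (fst z + snd z) * h (snd z - fst z) * k (snd z) = 0" if "z \<notin> K" for z
    using that f(3)[of "fst z + snd z"] h(3)[of "snd z - fst z"] k(3)[of "snd z"] by (auto simp: K_def)
  ultimately show "\<exists>K. compact K \<and> K \<subseteq> test_domain R T \<and>
      (\<forall>z. z \<notin> K \<longrightarrow> f (fst z + snd z) * h (snd z - fst z) * k (snd z) = 0)" by blast
qed

lemma eventually_zero_imp_DERIV_zero:
  fixes f :: "real \<Rightarrow> real"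
  assumes f: "\<And>x. (f has_real_derivative f1 x) (at x)" and c: "continuous_on UNIV f1"
    and 0: "\<And>x. x \<ge> b \<Longrightarrow> f x = 0" and "x \<ge> b"
  shows "f1 x = 0"
proof -
  have gt: "f1 y = 0" if "y > b" for y
  proof (rule DERIV_unique[OF f])
    show "(f has_real_derivative 0) (at y)"
      by (rule DERIV_cong_ev[THEN iffD2, OF refl _ refl DERIV_const[of 0]])
         (use eventually_gt_at_top eventually_nhds_in_open[of "{b<..}" y] that 0 in \<open>auto elim!: eventually_mono\<close>)
  qed
  show ?thesis
  proof (rule tendsto_unique)
    show "(f1 \<longlongrightarrow> f1 x) (at_right x)"
      using c by (simp add: continuous_on_def continuous_on_eq_continuous_at isCont_def filterlim_at_split)
    show "(f1 \<longlongrightarrow> 0) (at_right x)"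
      by (rule tendsto_eventually, rule eventually_at_rightI[of x "x + 1"]) (use gt \<open>x \<ge> b\<close> in auto)
  qed simp
qed

text \<open>For \<open>\<eta> = f(r + t) h(t - r)\<close> the second derivatives of \<open>f\<close> and of \<open>h\<close> cancel in \<open>\<eta>_tt - \<eta>_rr\<close>, which
  leaves \<open>4 f' h'\<close>.\<close>

lemma null_product_identity:
  fixes n :: nat
  defines "m \<equiv> (real n - 1) / 2"
  assumes sol: "solution_class n R T u ur ut" and init: "\<And>r. r > R \<Longrightarrow> u (r, 0) = 0"
    and eq: "\<And>\<phi> \<phi>r \<phi>t. test_function (test_domain R T) \<phi> \<phi>r \<phi>t \<Longrightarrow>
        (LINT z:Theta R T|lborel. fst z ^ (n - 1) * (ur z * \<phi>r z - ut z * \<phi>t z - g (fst z) (u z) * \<phi> z))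
      = (LINT r:{R<..}|lborel. r ^ (n - 1) * \<psi> r * \<phi> (r, 0))"
    and n: "n \<ge> 1" and R: "R > 0" and T: "T > 0"
    and g: "continuous_on ({R<..} \<times> UNIV) (\<lambda>(r, v). g r v)"
    and f: "\<And>x. (f has_real_derivative f1 x) (at x)" "\<And>x. (f1 has_real_derivative f2 x) (at x)"
      "continuous_on UNIV f2" "\<And>x. x \<ge> b \<Longrightarrow> f x = 0"
    and h: "\<And>x. (h has_real_derivative h1 x) (at x)" "\<And>x. (h1 has_real_derivative h2 x) (at x)"
      "continuous_on UNIV h2" "\<And>x. x \<ge> c \<Longrightarrow> h x = 0"
    and bc: "R < - c" "b + c < 2 * T"
  shows "(LINT z:Theta R T|lborel. fst z powr m * u z * (4 * (f1 (fst z + snd z) * h1 (snd z - fst z))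
       + m * (m - 1) / (fst z)\<^sup>2 * (f (fst z + snd z) * h (snd z - fst z))))
    = (LINT z:Theta R T|lborel. fst z powr m * g (fst z) (u z) * (f (fst z + snd z) * h (snd z - fst z)))
      + (LINT r:{R<..}|lborel. r powr m * \<psi> r * (f r * h (- r)))"
proof -
  have Theta0: "0 \<le> snd z" if "z \<in> Theta R T" for z using that by (auto simp: Theta_def)
  \<comment> \<open>For \<open>t < 0\<close> the product is not compactly supported. The factor \<open>k\<close> cuts it off between \<open>- s\<close> and \<open>0\<close>, before the support reaches \<open>r = R\<close>; it is \<open>1\<close> on the domain of the solution.\<close>
  define s where "s = (- c - R) / 2"
  have s: "R < - c - s" "s > 0" using bc by (auto simp: s_def field_simps)
  define k where "k t = smoothstep (t / s + 1)" for t
  define k1 where "k1 t = smoothstep_d1 (t / s + 1) * (1 / s)" for t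
  define k2 where "k2 t = smoothstep_d2 (t / s + 1) * (1 / s) * (1 / s)" for t
  have k: "(k has_real_derivative k1 t) (at t)" "(k1 has_real_derivative k2 t) (at t)" for t
  proof -
    have a: "((\<lambda>t. t / s + 1) has_real_derivative 1 / s) (at t)"
      using s by (auto intro!: derivative_eq_intros)
    show "(k has_real_derivative k1 t) (at t)" "(k1 has_real_derivative k2 t) (at t)"
      unfolding k_def[abs_def] k1_def[abs_def] k2_def
      by (intro DERIV_cmult_right DERIV_chain2[OF DERIV_smoothstep a] DERIV_chain2[OF DERIV_smoothstep_d1 a])+
  qed
  have c1: "continuous_on UNIV f1" "continuous_on UNIV h1" "continuous_on UNIV k1"
    using f h k by (auto intro!: continuous_at_imp_continuous_on DERIV_isCont)
  have c2: "continuous_on UNIV k2"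
    unfolding k2_def by (intro continuous_intros continuous_on_compose2[OF continuous_smoothstep_d2[of UNIV]]) (use s in auto)
  have k0: "k t = 0" "k1 t = 0" if "t \<le> - s" for t
  proof -
    have "t / s + 1 \<le> 0" using that s by (simp add: field_simps)
    then show "k t = 0" "k1 t = 0" by (auto simp: k_def k1_def smoothstep_left)
  qed
  have kp: "k t = 1" "k1 t = 0" "k2 t = 0" if "0 \<le> t" for t
  proof -
    have "t / s + 1 \<ge> 1" using that s by (simp add: field_simps)
    then show "k t = 1" "k1 t = 0" "k2 t = 0" by (auto simp: k_def k1_def k2_def smoothstep_right)
  qed
  note f10 = eventually_zero_imp_DERIV_zero[OF f(1) c1(1) f(4)]
  note h10 = eventually_zero_imp_DERIV_zero[OF h(1) c1(2) h(4)]
  have test: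
    "test_function (test_domain R T)
    (\<lambda>z. f (fst z + snd z) * h (snd z - fst z) * k (snd z))
    (\<lambda>z. f1 (fst z + snd z) * h (snd z - fst z) * k (snd z) - f (fst z + snd z) * h1 (snd z - fst z) * k (snd z))
    (\<lambda>z. f1 (fst z + snd z) * h (snd z - fst z) * k (snd z) + f (fst z + snd z) * h1 (snd z - fst z) * k (snd z)
        + f (fst z + snd z) * h (snd z - fst z) * k1 (snd z))"
    by (rule test_function_null_product[OF f(1) c1(1) f(4) h(1) c1(2) h(4) k(1) c1(3) k0(1) s bc(2)])
  note t_f1hk = test_function_null_product[OF f(2,3) f10 h(1) c1(2) h(4) k(1) c1(3) k0(1) s bc(2)]
    and t_fh1k = test_function_null_product[OF f(1) c1(1) f(4) h(2,3) h10 k(1) c1(3) k0(1) s bc(2)]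
    and t_fhk1 = test_function_null_product[OF f(1) c1(1) f(4) h(1) c1(2) h(4) k(2) c2 k0(2) s bc(2)]
  note main = very_weak_wave_equation[OF sol init eq n R T g test test_function_diff[OF t_f1hk t_fh1k]
      test_function_add[OF test_function_add[OF t_f1hk t_fh1k] t_fhk1], folded m_def]
  have "(LINT z:Theta R T|lborel. fst z powr m * u z * (4 * (f1 (fst z + snd z) * h1 (snd z - fst z))
       + m * (m - 1) / (fst z)\<^sup>2 * (f (fst z + snd z) * h (snd z - fst z))))
    = (LINT z:Theta R T|lborel. fst z powr m * g (fst z) (u z) * (f (fst z + snd z) * h (snd z - fst z) * k (snd z)))
      + (LINT r:{R<..}|lborel. r powr m * \<psi> r * (f (r + 0) * h (0 - r) * k 0))"
    by (rule trans[OF set_lebesgue_integral_cong main[unfolded fst_conv snd_conv]])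
       (auto simp: Theta_borel kp dest: Theta0)
  also have "(LINT z:Theta R T|lborel. fst z powr m * g (fst z) (u z) * (f (fst z + snd z) * h (snd z - fst z) * k (snd z)))
    = (LINT z:Theta R T|lborel. fst z powr m * g (fst z) (u z) * (f (fst z + snd z) * h (snd z - fst z)))"
    by (rule set_lebesgue_integral_cong) (auto simp: Theta_borel kp dest: Theta0)
  finally show ?thesis by (simp add: kp)
qed

section \<open>Backward triangles\<close>

text \<open>The part in \<open>t \<ge> 0\<close> of the backward light cone of \<open>P\<close>, that is, its domain of dependence.\<close>

definition past :: "real \<times> real \<Rightarrow> (real \<times> real) set" where
  "past P = {z. 0 \<le> snd z \<and> \<bar>fst z - fst P\<bar> \<le> snd P - snd z}"

lemma past_subset_rectangle:
  "past P \<subseteq> cbox (fst P - snd P, 0) (fst P + snd P, snd P)"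
  by (auto simp: past_def)

lemma compact_past: "compact (past P)"
proof -
  have "past P = {z. 0 \<le> snd z} \<inter> {z. \<bar>fst z - fst P\<bar> \<le> snd P - snd z}" by (auto simp: past_def)
  then have "closed (past P)"
    by (simp only:) (intro closed_Int closed_Collect_le continuous_intros)
  then show ?thesis
    using bounded_subset[OF bounded_cbox past_subset_rectangle] by (simp add: compact_eq_bounded_closed)
qed

lemma past_borel [measurable]: "past P \<in> sets borel"
  using compact_imp_closed[OF compact_past] by (rule borel_closed)

lemma past_trans: "Q \<in> past P \<Longrightarrow> past Q \<subseteq> past P"
  by (auto simp: past_def)

lemma past_subset_Theta: "R < fst P - snd P \<Longrightarrow> snd P < T \<Longrightarrow> past P \<subseteq> Theta R T"
  by (auto simp: past_def Theta_def)

lemma measure_past_le: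
  assumes "0 \<le> snd P"
  shows "measure lborel (past P) \<le> 2 * (snd P)\<^sup>2"
proof -
  have "measure lborel (past P) \<le> measure lborel (cbox (fst P - snd P, 0) (fst P + snd P, snd P))"
    by (intro measure_mono_fmeasurable past_subset_rectangle) auto
  also have "\<dots> = 2 * (snd P)\<^sup>2"
    using assms by (subst measure_lborel_rectangle) (auto simp: power2_eq_square)
  finally show ?thesis .
qed

section \<open>Mollified steps and bumps\<close>

text \<open>A decreasing step from \<open>1\<close> for \<open>x \<le> a\<close> to \<open>0\<close> for \<open>x \<ge> a + \<delta>\<close>. The function \<open>bump \<delta> a\<close> below is minus its
  derivative, a probability density on the interval from \<open>a\<close> to \<open>a + \<delta>\<close>.\<close>

definition soft_cutoff :: "real \<Rightarrow> real \<Rightarrow> real \<Rightarrow> real" where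
  "soft_cutoff \<delta> a x = smoothstep (1 + (a - x) / \<delta>)"
definition bump :: "real \<Rightarrow> real \<Rightarrow> real \<Rightarrow> real" where
  "bump \<delta> a x = smoothstep_d1 (1 + (a - x) / \<delta>) / \<delta>"

lemma DERIV_soft_cutoff:
  assumes "\<delta> > 0" shows "(soft_cutoff \<delta> a has_real_derivative - bump \<delta> a x) (at x)"
proof -
  have a: "((\<lambda>x. 1 + (a - x) / \<delta>) has_real_derivative - 1 / \<delta>) (at x)"
    using assms by (auto intro!: derivative_eq_intros)
  from DERIV_chain2[OF DERIV_smoothstep this] show ?thesis
    by (simp add: soft_cutoff_def[abs_def] bump_def)
qed

lemma DERIV_bump:
  assumes "\<delta> > 0"
  shows "((\<lambda>x. - bump \<delta> a x) has_real_derivative smoothstep_d2 (1 + (a - x) / \<delta>) / \<delta> / \<delta>) (at x)"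
proof -
  have a: "((\<lambda>x. 1 + (a - x) / \<delta>) has_real_derivative - 1 / \<delta>) (at x)"
    using assms by (auto intro!: derivative_eq_intros)
  from DERIV_cmult_right[OF DERIV_chain2[OF DERIV_smoothstep_d1 this], of "- 1 / \<delta>"] show ?thesis
    by (simp add: bump_def[abs_def])
qed

lemma continuous_soft_cutoff: "continuous_on A (soft_cutoff \<delta> a)"
  unfolding soft_cutoff_def divide_inverse
  by (intro continuous_on_compose2[OF continuous_smoothstep[of UNIV]] continuous_intros) auto

lemma continuous_bump: "continuous_on A (bump \<delta> a)"
  unfolding bump_def divide_inverse
  by (intro continuous_on_mult continuous_on_const continuous_on_compose2[OF continuous_smoothstep_d1[of UNIV]] continuous_intros) auto

lemma soft_cutoff_bounds: "0 \<le> soft_cutoff \<delta> a x" "soft_cutoff \<delta> a x \<le> 1"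
  by (simp_all add: soft_cutoff_def smoothstep_bounds)

lemma bump_nonneg: "\<delta> > 0 \<Longrightarrow> 0 \<le> bump \<delta> a x"
  by (simp add: bump_def smoothstep_d1_bounds)

lemma soft_cutoff_eq:
  assumes "\<delta> > 0"
  shows "x \<le> a \<Longrightarrow> soft_cutoff \<delta> a x = 1" "x \<ge> a + \<delta> \<Longrightarrow> soft_cutoff \<delta> a x = 0"
    and "x \<le> a \<Longrightarrow> bump \<delta> a x = 0" "x \<ge> a + \<delta> \<Longrightarrow> bump \<delta> a x = 0"
proof -
  have 1: "1 \<le> 1 + (a - x) / \<delta>" if "x \<le> a" using that assms by simp
  have 2: "1 + (a - x) / \<delta> \<le> 0" if "x \<ge> a + \<delta>" using that assms by (simp add: field_simps)
  show "x \<le> a \<Longrightarrow> soft_cutoff \<delta> a x = 1" "x \<le> a \<Longrightarrow> bump \<delta> a x = 0"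
    using smoothstep_right[OF 1] by (auto simp: soft_cutoff_def bump_def)
  show "x \<ge> a + \<delta> \<Longrightarrow> soft_cutoff \<delta> a x = 0" "x \<ge> a + \<delta> \<Longrightarrow> bump \<delta> a x = 0"
    using smoothstep_left[OF 2] by (auto simp: soft_cutoff_def bump_def)
qed

lemma nn_integral_bump:
  assumes "\<delta> > 0"
  shows "(\<integral>\<^sup>+x. ennreal (bump \<delta> a x) \<partial>lborel) = 1"
proof -
  have m: "smoothstep_d1 \<in> borel_measurable borel"
    by (intro borel_measurable_continuous_onI continuous_smoothstep_d1)
  have "(\<integral>\<^sup>+x. ennreal (smoothstep_d1 x) \<partial>lborel) = (\<integral>\<^sup>+x. ennreal (smoothstep_d1 x) * indicator {0..1} x \<partial>lborel)"
    by (intro nn_integral_cong) (auto simp: indicator_def smoothstep_left smoothstep_right not_le)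
  also have "\<dots> = ennreal (smoothstep 1 - smoothstep 0)"
    by (rule nn_integral_FTC_Icc)
       (use m in \<open>auto intro: DERIV_smoothstep smoothstep_d1_bounds has_field_derivative_at_within\<close>)
  finally have 1: "(\<integral>\<^sup>+x. ennreal (smoothstep_d1 x) \<partial>lborel) = 1" by (simp add: smoothstep_left smoothstep_right)
  have "1 = (\<integral>\<^sup>+x. ennreal (smoothstep_d1 x) \<partial>lborel)" using 1 by simp
  also have "\<dots> = ennreal \<bar>- 1 / \<delta>\<bar> * (\<integral>\<^sup>+x. ennreal (smoothstep_d1 (1 + a / \<delta> + (- 1 / \<delta>) * x)) \<partial>lborel)"
    by (rule nn_integral_real_affine) (use m assms in auto)
  also have "\<dots> = (\<integral>\<^sup>+x. ennreal (1 / \<delta>) * ennreal (smoothstep_d1 (1 + a / \<delta> + (- 1 / \<delta>) * x)) \<partial>lborel)"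
    using assms m by (subst nn_integral_cmult) auto
  also have "\<dots> = (\<integral>\<^sup>+x. ennreal (bump \<delta> a x) \<partial>lborel)"
    using assms smoothstep_d1_bounds
    by (intro nn_integral_cong)
       (simp add: bump_def diff_divide_distrib algebra_simps flip: ennreal_mult)
  finally show ?thesis by simp
qed

text \<open>The null coordinates \<open>r + t\<close> and \<open>t - r\<close> have Jacobian \<open>2\<close>. The change of variables is carried out by
  translations of the line inside Tonelli's theorem.\<close>

lemma nn_integral_null_product:
  fixes f h :: "real \<Rightarrow> ennreal"
  assumes [measurable]: "f \<in> borel_measurable borel" "h \<in> borel_measurable borel"
  shows "2 * (\<integral>\<^sup>+z. f (fst z + snd z) * h (snd z - fst z) \<partial>lborel)
    = (\<integral>\<^sup>+x. f x \<partial>lborel) * (\<integral>\<^sup>+x. h x \<partial>lborel)"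
proof -
  have "(\<integral>\<^sup>+z. f (fst z + snd z) * h (snd z - fst z) \<partial>lborel)
    = (\<integral>\<^sup>+z. f (fst z + snd z) * h (snd z - fst z) \<partial>(lborel \<Otimes>\<^sub>M lborel))"
    by (simp add: lborel_prod)
  also have "\<dots> = (\<integral>\<^sup>+t. (\<integral>\<^sup>+r. f (r + t) * h (t - r) \<partial>lborel) \<partial>lborel)"
    by (subst lborel_pair.nn_integral_snd[symmetric]) (auto simp: split_beta)
  \<comment> \<open>Substitution of \<open>x = r + t\<close> at fixed \<open>t\<close>.\<close>
  also have "\<dots> = (\<integral>\<^sup>+t. (\<integral>\<^sup>+x. f x * h (2 * t - x) \<partial>lborel) \<partial>lborel)"
  proof (rule nn_integral_cong)
    fix t :: real
    have "(\<integral>\<^sup>+x. f x * h (2 * t - x) \<partial>lborel) = ennreal \<bar>1\<bar> * (\<integral>\<^sup>+r. f (t + 1 * r) * h (2 * t - (t + 1 * r)) \<partial>lborel)"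
      by (rule nn_integral_real_affine) auto
    then show "(\<integral>\<^sup>+r. f (r + t) * h (t - r) \<partial>lborel) = (\<integral>\<^sup>+x. f x * h (2 * t - x) \<partial>lborel)"
      by (simp add: add.commute)
  qed
  also have "\<dots> = (\<integral>\<^sup>+x. (\<integral>\<^sup>+t. f x * h (2 * t - x) \<partial>lborel) \<partial>lborel)"
    by (rule lborel_pair.Fubini') simp
  also have "\<dots> = (\<integral>\<^sup>+x. f x * (\<integral>\<^sup>+t. h (2 * t - x) \<partial>lborel) \<partial>lborel)"
    by (simp add: nn_integral_cmult)
  finally have 1: "(\<integral>\<^sup>+z. f (fst z + snd z) * h (snd z - fst z) \<partial>lborel)
    = (\<integral>\<^sup>+x. f x * (\<integral>\<^sup>+t. h (2 * t - x) \<partial>lborel) \<partial>lborel)" .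
  have 2: "2 * (\<integral>\<^sup>+t. h (2 * t - x) \<partial>lborel) = (\<integral>\<^sup>+y. h y \<partial>lborel)" for x
    using nn_integral_real_affine[of h 2 "- x"] by simp
  have "2 * (\<integral>\<^sup>+x. f x * (\<integral>\<^sup>+t. h (2 * t - x) \<partial>lborel) \<partial>lborel)
    = (\<integral>\<^sup>+x. f x * (2 * (\<integral>\<^sup>+t. h (2 * t - x) \<partial>lborel)) \<partial>lborel)"
    by (subst nn_integral_cmult[symmetric]) (auto simp: mult.left_commute)
  also have "\<dots> = (\<integral>\<^sup>+x. f x * (\<integral>\<^sup>+y. h y \<partial>lborel) \<partial>lborel)" by (simp only: 2)
  also have "\<dots> = (\<integral>\<^sup>+x. f x \<partial>lborel) * (\<integral>\<^sup>+x. h x \<partial>lborel)"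
    by (simp add: nn_integral_multc)
  finally show ?thesis using 1 by simp
qed

lemma has_bochner_integral_bump_product:
  assumes "\<delta> > 0"
  shows "has_bochner_integral lborel (\<lambda>z::real\<times>real. bump \<delta> a (fst z + snd z) * bump \<delta> b (snd z - fst z)) (1 / 2)"
proof (rule has_bochner_integral_nn_integral)
  have m: "bump \<delta> c \<in> borel_measurable borel" for c
    by (intro borel_measurable_continuous_onI continuous_bump)
  show "(\<lambda>z::real\<times>real. bump \<delta> a (fst z + snd z) * bump \<delta> b (snd z - fst z)) \<in> borel_measurable lborel"
    by (simp, intro borel_measurable_continuous_onI continuous_intros continuous_on_compose2[OF continuous_bump[of UNIV]]) auto
  have "2 * (\<integral>\<^sup>+z. ennreal (bump \<delta> a (fst z + snd z) * bump \<delta> b (snd z - fst z)) \<partial>lborel)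
    = 2 * (\<integral>\<^sup>+z. ennreal (bump \<delta> a (fst z + snd z)) * ennreal (bump \<delta> b (snd z - fst z)) \<partial>lborel)"
    using bump_nonneg[OF assms] by (simp add: ennreal_mult)
  also have "\<dots> = 1"
    using m by (subst nn_integral_null_product[of "\<lambda>x. ennreal (bump \<delta> a x)" "\<lambda>x. ennreal (bump \<delta> b x)"])
      (auto simp: nn_integral_bump[OF assms])
  finally have e: "2 * (\<integral>\<^sup>+z. ennreal (bump \<delta> a (fst z + snd z) * bump \<delta> b (snd z - fst z)) \<partial>lborel) = 1" .
  define X where "X = (\<integral>\<^sup>+z. ennreal (bump \<delta> a (fst z + snd z) * bump \<delta> b (snd z - fst z)) \<partial>lborel)"
  have "X = ennreal (1 / 2)"
  proof (cases X)
    case (real x)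
    then have "ennreal (2 * x) = ennreal 1" using e unfolding X_def[symmetric] by (simp add: ennreal_mult)
    then have "x = 1 / 2" using real by (subst (asm) ennreal_inj) auto
    then show ?thesis using real by (simp only:)
  next
    case top
    then show ?thesis using e unfolding X_def[symmetric] by simp
  qed
  then show "(\<integral>\<^sup>+z. ennreal (bump \<delta> a (fst z + snd z) * bump \<delta> b (snd z - fst z)) \<partial>lborel) = ennreal (1 / 2)"
    by (simp add: X_def)
qed (use bump_nonneg[OF assms] in auto)

lemma soft_cutoff_tendsto:
  assumes \<delta>: "\<And>j. \<delta> j > 0" "\<delta> \<longlonglongrightarrow> 0"
  shows "(\<lambda>j. soft_cutoff (\<delta> j) a x) \<longlonglongrightarrow> indicator {..a} x"
proof (cases "x \<le> a")
  case True
  then show ?thesis by (simp add: soft_cutoff_eq[OF \<delta>(1)])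
next
  case False
  then have "\<forall>\<^sub>F j in sequentially. \<delta> j < x - a" using \<delta>(2) by (intro order_tendstoD) auto
  then have "\<forall>\<^sub>F j in sequentially. soft_cutoff (\<delta> j) a x = 0"
    by eventually_elim (rule soft_cutoff_eq[OF \<delta>(1)], simp)
  then show ?thesis using False by (simp add: tendsto_eventually)
qed

section \<open>D'Alembert's formula\<close>

text \<open>The kernel is nonnegative, has integral \<open>2\<close>, and is supported in a square with lowest corner \<open>P\<close> and
  sides \<open>\<delta> j\<close> in null coordinates. This square lies above \<open>P\<close>, so it is contained in the domain
  even if \<open>P\<close> is on the initial line.\<close>

lemma bump_product_tendsto:
  fixes v :: "real \<times> real \<Rightarrow> real"
  assumes v: "continuous_on (Theta R T) v" and P: "R < fst P - snd P" "0 \<le> snd P" "snd P < T"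
    and \<delta>: "\<And>j. \<delta> j > 0" "\<delta> \<longlonglongrightarrow> 0"
    and \<delta>0: "\<And>j. \<delta> j \<le> d0" "R < fst P - snd P - d0" "snd P + d0 < T"
  shows "(\<lambda>j. LINT z:Theta R T|lborel. v z * (4 * (bump (\<delta> j) (fst P + snd P) (fst z + snd z) * bump (\<delta> j) (snd P - fst P) (snd z - fst z))))
     \<longlonglongrightarrow> 2 * v P"
proof (rule LIMSEQ_I)
  fix e :: real assume "e > 0"
  define k where "k j z = 4 * (bump (\<delta> j) (fst P + snd P) (fst z + snd z) * bump (\<delta> j) (snd P - fst P) (snd z - fst z))" for j z
  have k: "has_bochner_integral lborel (k j) 2" for j
    using has_bochner_integral_mult_right[OF has_bochner_integral_bump_product[OF \<delta>(1)], where c = "4"]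
    by (simp add: k_def[abs_def])
  have k0: "k j z \<ge> 0" for j z using bump_nonneg[OF \<delta>(1)] by (simp add: k_def)
  have ksupp: "k j z = 0 \<or> (fst P + snd P < fst z + snd z \<and> fst z + snd z < fst P + snd P + \<delta> j
     \<and> snd P - fst P < snd z - fst z \<and> snd z - fst z < snd P - fst P + \<delta> j)" for j z
    using soft_cutoff_eq(3)[OF \<delta>(1)[of j], of "fst z + snd z" "fst P + snd P"]
      soft_cutoff_eq(3)[OF \<delta>(1)[of j], of "snd z - fst z" "snd P - fst P"]
      soft_cutoff_eq(4)[OF \<delta>(1)[of j], of "fst P + snd P" "fst z + snd z"]
      soft_cutoff_eq(4)[OF \<delta>(1)[of j], of "snd P - fst P" "snd z - fst z"]
    by (auto simp: k_def simp flip: not_le)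
  have kTheta: "z \<in> Theta R T \<and> \<bar>fst z - fst P\<bar> \<le> \<delta> j \<and> \<bar>snd z - snd P\<bar> \<le> \<delta> j" if "k j z \<noteq> 0" for j z
    using ksupp[of j z] that P \<delta>0(1)[of j] \<delta>0(2,3) \<delta>(1)[of j] by (cases z) (auto simp: Theta_def abs_le_iff)
  have PT: "P \<in> Theta R T" using P by (cases P) (auto simp: Theta_def)
  obtain d where d: "d > 0" "\<And>z. z \<in> Theta R T \<Longrightarrow> dist z P < d \<Longrightarrow> dist (v z) (v P) < e / 4"
    using v PT \<open>e > 0\<close> unfolding continuous_on_iff by (metis divide_pos_pos zero_less_numeral)
  have "\<forall>\<^sub>F j in sequentially. \<delta> j < d / 2" using \<delta>(2) d by (intro order_tendstoD) auto
  then obtain N where N: "\<And>j. N \<le> j \<Longrightarrow> \<delta> j < d / 2" by (auto simp: eventually_sequentially)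
  have "norm ((LINT z:Theta R T|lborel. v z * k j z) - 2 * v P) < e" if "N \<le> j" for j
  proof -
    have pt: "\<bar>indicator (Theta R T) z * (v z * k j z) - v P * k j z\<bar> \<le> e / 4 * k j z" for z
    proof (cases "k j z = 0")
      case False
      note z = kTheta[OF False]
      have "dist z P \<le> \<bar>fst z - fst P\<bar> + \<bar>snd z - snd P\<bar>"
        by (cases z; cases P) (auto simp: dist_Pair_Pair dist_real_def intro: sqrt_sum_squares_le_sum_abs)
      then have "dist z P < d" using z N[OF that] by linarith
      then have "\<bar>v z - v P\<bar> \<le> e / 4" using d(2)[of z] z by (simp add: dist_real_def)
      then have "\<bar>v z - v P\<bar> * k j z \<le> e / 4 * k j z" using k0 by (intro mult_right_mono)
      moreover have "\<bar>indicator (Theta R T) z * (v z * k j z) - v P * k j z\<bar> = \<bar>v z - v P\<bar> * k j z"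
        using z k0[of j z] by (simp add: abs_mult flip: left_diff_distrib)
      ultimately show ?thesis by simp
    qed simp
    have ik: "integrable lborel (k j)" "integral\<^sup>L lborel (k j) = 2"
      using k[of j] by (auto simp: has_bochner_integral_iff)
    have int: "integrable lborel (\<lambda>z. indicator (Theta R T) z * (v z * k j z))"
    proof -
      have "(\<lambda>z. indicator (Theta R T) z *\<^sub>R v z) \<in> borel_measurable borel"
        by (intro borel_measurable_continuous_on_indicator v Theta_borel)
      then have "(\<lambda>z. indicator (Theta R T) z * v z * k j z) \<in> borel_measurable lborel"
        using borel_measurable_times[of "\<lambda>z. indicator (Theta R T) z * v z" lborel "k j"]
          borel_measurable_integrable[OF ik(1)] by simp
      then have m: "(\<lambda>z. indicator (Theta R T) z * (v z * k j z)) \<in> borel_measurable lborel"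
        by (simp add: mult.assoc)
      show ?thesis
      proof (rule Bochner_Integration.integrable_bound[OF _ m])
        show "integrable lborel (\<lambda>z. (\<bar>v P\<bar> + e / 4) * k j z)" using ik by simp
        have "\<bar>indicator (Theta R T) z * (v z * k j z)\<bar> \<le> (\<bar>v P\<bar> + e / 4) * k j z" for z
          using pt[of z] k0[of j z] abs_mult[of "v P" "k j z"]
            abs_triangle_ineq2[of "indicator (Theta R T) z * (v z * k j z)" "v P * k j z"]
          by (simp add: distrib_right)
        then show "AE z in lborel. norm (indicator (Theta R T) z * (v z * k j z)) \<le> norm ((\<bar>v P\<bar> + e / 4) * k j z)"
          using k0 \<open>e > 0\<close> by (auto intro: order_trans[OF _ abs_ge_self])
      qed
    qed
    have "(LINT z:Theta R T|lborel. v z * k j z) - 2 * v P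
      = (LINT z|lborel. indicator (Theta R T) z * (v z * k j z) - v P * k j z)"
      using int ik by (simp add: set_lebesgue_integral_def)
    also have "norm \<dots> \<le> (LINT z|lborel. norm (indicator (Theta R T) z * (v z * k j z) - v P * k j z))"
      by (rule integral_norm_bound)
    also have "\<dots> \<le> (LINT z|lborel. e / 4 * k j z)"
      by (rule integral_mono') (use ik pt k0 \<open>e > 0\<close> in auto)
    also have "\<dots> = e / 2" using ik by simp
    also have "\<dots> < e" using \<open>e > 0\<close> by simp
    finally show ?thesis .
  qed
  then show "\<exists>no. \<forall>j\<ge>no. norm ((LINT z:Theta R T|lborel. v z * (4 * (bump (\<delta> j) (fst P + snd P) (fst z + snd z) * bump (\<delta> j) (snd P - fst P) (snd z - fst z)))) - 2 * v P) < e"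
    unfolding k_def by blast
qed

text \<open>The product of the two steps converges pointwise to the indicator function of \<open>past P\<close> and, inside
  the domain, is supported in the fixed triangle with vertex \<open>(fst P, snd P + d0)\<close>, so that dominated
  convergence applies.\<close>

lemma soft_cutoff_product_tendsto:
  fixes q :: "real \<times> real \<Rightarrow> real"
  assumes q: "continuous_on (Theta R T) q" and P: "R < fst P - snd P" "0 \<le> snd P" "snd P < T"
    and \<delta>: "\<And>j. \<delta> j > 0" "\<delta> \<longlonglongrightarrow> 0"
    and \<delta>0: "\<And>j. \<delta> j \<le> d0" "R < fst P - snd P - d0" "snd P + d0 < T"
  shows "(\<lambda>j. LINT z:Theta R T|lborel. q z * (soft_cutoff (\<delta> j) (fst P + snd P) (fst z + snd z) * soft_cutoff (\<delta> j) (snd P - fst P) (snd z - fst z)))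
     \<longlonglongrightarrow> (LINT z:past P|lborel. q z)"
    (is "(\<lambda>j. ?I j) \<longlonglongrightarrow> _")
    and "set_integrable lborel (Theta R T) (\<lambda>z. q z * (soft_cutoff (\<delta> j) (fst P + snd P) (fst z + snd z) * soft_cutoff (\<delta> j) (snd P - fst P) (snd z - fst z)))"
proof -
  define f where "f j z = soft_cutoff (\<delta> j) (fst P + snd P) (fst z + snd z) * soft_cutoff (\<delta> j) (snd P - fst P) (snd z - fst z)" for j z
  have f01: "0 \<le> f j z" "f j z \<le> 1" for j z
    using soft_cutoff_bounds by (auto simp: f_def intro!: mult_le_one)
  define L where "L = past (fst P, snd P + d0)"
  have L: "L \<subseteq> Theta R T" "compact L"
    using past_subset_Theta[of R "(fst P, snd P + d0)" T] \<delta>0 compact_past by (auto simp: L_def)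
  have f0: "f j z = 0" if "z \<in> Theta R T - L" for j z
  proof -
    have "0 \<le> snd z" "\<not> (\<bar>fst z - fst P\<bar> \<le> snd P + d0 - snd z)"
      using that by (auto simp: L_def past_def Theta_def)
    then have "fst z + snd z \<ge> fst P + snd P + \<delta> j \<or> snd z - fst z \<ge> snd P - fst P + \<delta> j"
      using \<delta>0(1)[of j] by linarith
    then show ?thesis using soft_cutoff_eq(2)[OF \<delta>(1)[of j]] by (auto simp: f_def)
  qed
  have qL: "set_integrable lborel L q"
    using L q by (intro set_integrable_compact) (auto intro: continuous_on_subset)
  have mq: "(\<lambda>z. indicator (Theta R T) z *\<^sub>R q z) \<in> borel_measurable lborel"
    using borel_measurable_continuous_on_indicator[OF _ q] Theta_borel by simp
  have mf: "(\<lambda>z. f j z) \<in> borel_measurable lborel" for j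
    unfolding f_def
    by (simp, intro borel_measurable_continuous_onI continuous_intros continuous_on_compose2[OF continuous_soft_cutoff[of UNIV]]) auto
  have m: "(\<lambda>z. indicator (Theta R T) z *\<^sub>R (q z * f j z)) \<in> borel_measurable lborel" for j
    using borel_measurable_times[OF _ mf, of "\<lambda>z. indicator (Theta R T) z * q z"] mq by (simp add: mult.assoc)
  have bound: "norm (indicator (Theta R T) z *\<^sub>R (q z * f j z)) \<le> norm (indicator L z *\<^sub>R q z)" for z j
  proof (cases "z \<in> L")
    case True
    have "\<bar>q z\<bar> * f j z \<le> \<bar>q z\<bar> * 1" using f01[of j z] by (intro mult_left_mono) auto
    moreover have "z \<in> Theta R T" using True L by auto
    ultimately show ?thesis using True f01[of j z] by (simp add: abs_mult)
  next
    case False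
    then show ?thesis using f0[of z j] by (auto simp: indicator_def)
  qed
  have lim: "(\<lambda>j. indicator (Theta R T) z *\<^sub>R (q z * f j z)) \<longlonglongrightarrow> indicator (past P) z *\<^sub>R q z" for z
  proof -
    have "(\<lambda>j. indicator (Theta R T) z *\<^sub>R (q z * f j z)) \<longlonglongrightarrow>
      indicator (Theta R T) z *\<^sub>R (q z * (indicator {..fst P + snd P} (fst z + snd z) * indicator {..snd P - fst P} (snd z - fst z)))"
      unfolding f_def by (intro tendsto_intros soft_cutoff_tendsto \<delta>)
    also have "indicator (Theta R T) z *\<^sub>R (q z * (indicator {..fst P + snd P} (fst z + snd z) * indicator {..snd P - fst P} (snd z - fst z)))
      = indicator (past P) z *\<^sub>R q z"
    proof -
      have "z \<in> past P \<longleftrightarrow> z \<in> Theta R T \<and> fst z + snd z \<le> fst P + snd P \<and> snd z - fst z \<le> snd P - fst P"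
        using P by (cases z) (auto simp: past_def Theta_def abs_le_iff)
      then show ?thesis by (auto simp: indicator_def)
    qed
    finally show ?thesis .
  qed
  have mpast: "(\<lambda>z. indicator (past P) z *\<^sub>R q z) \<in> borel_measurable lborel"
    using borel_measurable_continuous_on_indicator[OF past_borel continuous_on_subset[OF q past_subset_Theta[OF P(1,3)]]] by simp
  have iL: "integrable lborel (\<lambda>z. norm (indicator L z *\<^sub>R q z))"
    using qL by (auto simp: set_integrable_def)
  show "(\<lambda>j. ?I j) \<longlonglongrightarrow> (LINT z:past P|lborel. q z)"
    using integral_dominated_convergence[OF mpast m iL] lim bound
    by (auto simp: set_lebesgue_integral_def f_def)
  show "set_integrable lborel (Theta R T) (\<lambda>z. q z * (soft_cutoff (\<delta> j) (fst P + snd P) (fst z + snd z) * soft_cutoff (\<delta> j) (snd P - fst P) (snd z - fst z)))"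
    using Bochner_Integration.integrable_bound[OF iL m[of j]] bound[of _ j]
    by (simp add: set_integrable_def f_def)
qed

lemma soft_cutoff_initial_tendsto:
  fixes q :: "real \<Rightarrow> real"
  assumes q: "continuous_on {R<..} q" and P: "R < fst P - snd P" "0 \<le> snd P"
    and \<delta>: "\<And>j. \<delta> j > 0" "\<delta> \<longlonglongrightarrow> 0"
    and \<delta>0: "\<And>j. \<delta> j \<le> d0" "R < fst P - snd P - d0"
  shows "(\<lambda>j. LINT r:{R<..}|lborel. q r * (soft_cutoff (\<delta> j) (fst P + snd P) r * soft_cutoff (\<delta> j) (snd P - fst P) (- r)))
     \<longlonglongrightarrow> (LINT r:{fst P - snd P..fst P + snd P}|lborel. q r)"
    (is "(\<lambda>j. ?I j) \<longlonglongrightarrow> _")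
proof -
  define f where "f j r = soft_cutoff (\<delta> j) (fst P + snd P) r * soft_cutoff (\<delta> j) (snd P - fst P) (- r)" for j r
  have f01: "0 \<le> f j z" "f j z \<le> 1" for j z
    using soft_cutoff_bounds by (auto simp: f_def intro!: mult_le_one)
  define L where "L = {fst P - snd P - d0..fst P + snd P + d0}"
  have L: "L \<subseteq> {R<..}" "compact L"
    using \<delta>0 by (auto simp: L_def)
  have f0: "f j r = 0" if "r \<notin> L" for j r
  proof -
    have "r \<ge> fst P + snd P + \<delta> j \<or> - r \<ge> snd P - fst P + \<delta> j"
      using \<delta>0(1)[of j] that by (auto simp: L_def not_le)
    then show ?thesis using soft_cutoff_eq(2)[OF \<delta>(1)[of j]] by (auto simp: f_def)
  qed
  have qL: "set_integrable lborel L q"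
    using L q by (intro set_integrable_compact) (auto intro: continuous_on_subset)
  have mq: "(\<lambda>z. indicator {R<..} z *\<^sub>R q z) \<in> borel_measurable lborel"
    using borel_measurable_continuous_on_indicator[OF _ q] by simp
  have mf: "(\<lambda>z. f j z) \<in> borel_measurable lborel" for j
    unfolding f_def
    by (simp, intro borel_measurable_continuous_onI continuous_intros continuous_on_compose2[OF continuous_soft_cutoff[of UNIV]]) auto
  have m: "(\<lambda>z. indicator {R<..} z *\<^sub>R (q z * f j z)) \<in> borel_measurable lborel" for j
    using borel_measurable_times[OF _ mf, of "\<lambda>z. indicator {R<..} z * q z"] mq by (simp add: mult.assoc)
  have bound: "norm (indicator {R<..} z *\<^sub>R (q z * f j z)) \<le> norm (indicator L z *\<^sub>R q z)" for z j
  proof (cases "z \<in> L")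
    case True
    have "\<bar>q z\<bar> * f j z \<le> \<bar>q z\<bar> * 1" using f01[of j z] by (intro mult_left_mono) auto
    moreover have "z \<in> {R<..}" using True L by auto
    ultimately show ?thesis using True f01[of j z] by (simp add: abs_mult)
  next
    case False
    then show ?thesis using f0[of z j] by (auto simp: indicator_def)
  qed
  have lim: "(\<lambda>j. indicator {R<..} z *\<^sub>R (q z * f j z)) \<longlonglongrightarrow> indicator {fst P - snd P..fst P + snd P} z *\<^sub>R q z" for z
  proof -
    have "(\<lambda>j. indicator {R<..} z *\<^sub>R (q z * f j z)) \<longlonglongrightarrow>
      indicator {R<..} z *\<^sub>R (q z * (indicator {..fst P + snd P} z * indicator {..snd P - fst P} (- z)))"
      unfolding f_def by (intro tendsto_intros soft_cutoff_tendsto \<delta>)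
    also have "indicator {R<..} z *\<^sub>R (q z * (indicator {..fst P + snd P} z * indicator {..snd P - fst P} (- z)))
      = indicator {fst P - snd P..fst P + snd P} z *\<^sub>R q z"
      using P by (auto simp: indicator_def)
    finally show ?thesis .
  qed
  have mpast: "(\<lambda>z. indicator {fst P - snd P..fst P + snd P} z *\<^sub>R q z) \<in> borel_measurable lborel"
  proof -
    have "{fst P - snd P..fst P + snd P} \<subseteq> {R<..}" using P by auto
    from borel_measurable_continuous_on_indicator[OF _ continuous_on_subset[OF q this]] show ?thesis by simp
  qed
  have iL: "integrable lborel (\<lambda>z. norm (indicator L z *\<^sub>R q z))"
    using qL by (auto simp: set_integrable_def)
  show "(\<lambda>j. ?I j) \<longlonglongrightarrow> (LINT r:{fst P - snd P..fst P + snd P}|lborel. q r)"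
    using integral_dominated_convergence[OF mpast m iL] lim bound
    by (auto simp: set_lebesgue_integral_def f_def)
qed

text \<open>The null product identity is applied with steps that drop from \<open>1\<close> to \<open>0\<close> just beyond the two null lines
  through \<open>P\<close>. Letting their width tend to zero, the left side concentrates at the vertex and the
  right side at the triangle and its base.\<close>

lemma dalembert_formula:
  fixes n :: nat
  defines "m \<equiv> (real n - 1) / 2"
  assumes sol: "is_solution n R T g \<psi> u"
    and n: "n \<ge> 1" and R: "R > 0"
    and g: "continuous_on ({R<..} \<times> UNIV) (\<lambda>(r, v). g r v)"
    and \<psi>: "continuous_on {R<..} \<psi>"
    and P: "R < fst P - snd P" "0 \<le> snd P" "snd P < T"
  shows "2 * (fst P powr m * u P) = (LINT r:{fst P - snd P..fst P + snd P}|lborel. r powr m * \<psi> r)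
    + (LINT z:past P|lborel. fst z powr m * g (fst z) (u z) - m * (m - 1) / (fst z)\<^sup>2 * (fst z powr m * u z))"
proof -
  have T: "T > 0" using P by simp
  obtain ur ut where sc: "solution_class n R T u ur ut" and init: "\<And>r. r > R \<Longrightarrow> u (r, 0) = 0"
    and eq: "\<And>\<phi> \<phi>r \<phi>t. test_function (test_domain R T) \<phi> \<phi>r \<phi>t \<Longrightarrow>
        (LINT z:Theta R T|lborel. fst z ^ (n - 1) * (ur z * \<phi>r z - ut z * \<phi>t z - g (fst z) (u z) * \<phi> z))
      = (LINT r:{R<..}|lborel. r ^ (n - 1) * \<psi> r * \<phi> (r, 0))"
    using sol[unfolded is_solution_def, folded test_domain_def] by blast
  \<comment> \<open>Steps of width at most \<open>d0\<close> are supported away from the cone and from the final time.\<close>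
  define d0 where "d0 = min (fst P - snd P - R) (T - snd P) / 2"
  have d0: "d0 > 0" "R < fst P - snd P - d0" "snd P + d0 < T"
  proof -
    have d: "d0 \<le> (fst P - snd P - R) / 2" "d0 \<le> (T - snd P) / 2"
      by (auto simp: d0_def)
    show "R < fst P - snd P - d0" using d(1) P(1) by (simp add: field_simps)
    show "snd P + d0 < T" using d(2) P(3) by (simp add: field_simps)
    show "d0 > 0" using P by (simp add: d0_def)
  qed
  define \<delta> where "\<delta> j = d0 / real (Suc j)" for j
  have \<delta>: "\<delta> j > 0" "\<delta> j \<le> d0" for j using d0 by (auto simp: \<delta>_def field_simps)
  have \<delta>_lim: "\<delta> \<longlonglongrightarrow> 0"
    unfolding \<delta>_def using LIMSEQ_Suc[OF lim_const_over_n[of d0]] by simp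
  define x0 y0 where "x0 = fst P + snd P" and "y0 = snd P - fst P"
  define w where "w z = fst z powr m * u z" for z
  define a where "a z = m * (m - 1) / (fst z)\<^sup>2 * w z" for z
  define G where "G z = fst z powr m * g (fst z) (u z)" for z
  define D where "D j z = soft_cutoff (\<delta> j) x0 (fst z + snd z) * soft_cutoff (\<delta> j) y0 (snd z - fst z)" for j and z :: "real \<times> real"
  define K where "K j z = 4 * (bump (\<delta> j) x0 (fst z + snd z) * bump (\<delta> j) y0 (snd z - fst z))" for j and z :: "real \<times> real"
  have RTh: "fst z > R" "fst z \<noteq> 0" if "z \<in> Theta R T" for z using that R by (auto simp: Theta_def)
  have uc: "continuous_on (Theta R T) u" using sc by (simp add: solution_class_def)
  have wc: "continuous_on (Theta R T) w"
    unfolding w_def by (intro continuous_on_mult continuous_on_radial_powr[OF R RTh(1)] uc)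
  have ac: "continuous_on (Theta R T) a"
    unfolding a_def by (intro continuous_intros wc) (use RTh in auto)
  have Gc: "continuous_on (Theta R T) G"
    unfolding G_def
  proof (intro continuous_on_mult continuous_on_radial_powr[OF R RTh(1)])
    have "continuous_on (Theta R T) (\<lambda>z. (fst z, u z))"
      by (intro continuous_intros uc)
    moreover have "(\<lambda>z. (fst z, u z)) ` Theta R T \<subseteq> {R<..} \<times> UNIV"
      using RTh by auto
    ultimately show "continuous_on (Theta R T) (\<lambda>z. g (fst z) (u z))"
      using continuous_on_compose2[OF g, of "Theta R T" "\<lambda>z. (fst z, u z)"] by simp
  qed
  note limits = P \<delta>(1) \<delta>_lim \<delta>(2) d0(2,3)
  note lim_G = soft_cutoff_product_tendsto[OF Gc limits, folded x0_def y0_def D_def]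
    and lim_a = soft_cutoff_product_tendsto[OF ac limits, folded x0_def y0_def D_def]
    and lim_w = bump_product_tendsto[OF wc limits, folded x0_def y0_def K_def]
  have \<psi>c: "continuous_on {R<..} (\<lambda>r. r powr m * \<psi> r)"
    using R \<psi> by (intro continuous_intros) auto
  note lim_\<psi> = soft_cutoff_initial_tendsto[OF \<psi>c P(1,2) \<delta>(1) \<delta>_lim \<delta>(2) d0(2), folded x0_def y0_def]
  have c2: "continuous_on UNIV (\<lambda>x. smoothstep_d2 (1 + (b - x) / \<delta> j) / \<delta> j / \<delta> j)" for b j
    unfolding divide_inverse
    by (intro continuous_on_mult continuous_on_const continuous_on_compose2[OF continuous_smoothstep_d2[of UNIV]] continuous_intros) auto
  have id: "(LINT z:Theta R T|lborel. w z * K j z + a z * D j z)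
     = (LINT z:Theta R T|lborel. G z * D j z)
      + (LINT r:{R<..}|lborel. r powr m * \<psi> r * (soft_cutoff (\<delta> j) x0 r * soft_cutoff (\<delta> j) y0 (- r)))" for j
  proof -
    have bc: "R < - (y0 + \<delta> j)" "(x0 + \<delta> j) + (y0 + \<delta> j) < 2 * T"
      using d0 \<delta>(2)[of j] by (auto simp: x0_def y0_def)
    note null_product_identity[OF sc init eq n R T g
        DERIV_soft_cutoff[OF \<delta>(1)] DERIV_bump[OF \<delta>(1)] c2 soft_cutoff_eq(2)[OF \<delta>(1)]
        DERIV_soft_cutoff[OF \<delta>(1)] DERIV_bump[OF \<delta>(1)] c2 soft_cutoff_eq(2)[OF \<delta>(1)] bc, folded m_def]
    then show ?thesis by (simp add: w_def K_def a_def D_def G_def distrib_left mult.assoc mult.left_commute)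
  qed
  have intK: "set_integrable lborel (Theta R T) (\<lambda>z. w z * K j z)" for j
  proof -
    define L where "L = past (fst P, snd P + d0)"
    have L: "L \<subseteq> Theta R T" "compact L"
      using past_subset_Theta[of R "(fst P, snd P + d0)" T] d0 compact_past by (auto simp: L_def)
    have K0: "K j z = 0" if "z \<in> Theta R T - L" for z
    proof -
      have "0 \<le> snd z" "\<not> (\<bar>fst z - fst P\<bar> \<le> snd P + d0 - snd z)"
        using that by (auto simp: L_def past_def Theta_def)
      then have "fst z + snd z \<ge> x0 + \<delta> j \<or> snd z - fst z \<ge> y0 + \<delta> j"
        using \<delta>(2)[of j] unfolding x0_def y0_def by linarith
      then show ?thesis using soft_cutoff_eq(4)[OF \<delta>(1)[of j]] by (auto simp: K_def)
    qed
    have "continuous_on L (\<lambda>z. w z * K j z)"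
      unfolding K_def using L
      by (intro continuous_on_mult continuous_on_const continuous_on_subset[OF wc]
          continuous_on_compose2[OF continuous_bump[of UNIV]] continuous_intros) auto
    then show ?thesis
      by (intro set_integrable_extend_zero[OF set_integrable_compact L(1)] L(2)) (use K0 in auto)
  qed
  have split: "(LINT z:Theta R T|lborel. w z * K j z) = (LINT z:Theta R T|lborel. G z * D j z)
      + (LINT r:{R<..}|lborel. r powr m * \<psi> r * (soft_cutoff (\<delta> j) x0 r * soft_cutoff (\<delta> j) y0 (- r)))
      - (LINT z:Theta R T|lborel. a z * D j z)" for j
    using id[of j] set_integral_add(2)[OF intK[of j] lim_a(2)[of j]] by (simp add: D_def)
  have lim1: "(\<lambda>j. LINT z:Theta R T|lborel. w z * K j z) \<longlonglongrightarrow> (LINT z:past P|lborel. G z)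
      + (LINT r:{fst P - snd P..fst P + snd P}|lborel. r powr m * \<psi> r) - (LINT z:past P|lborel. a z)"
    unfolding split
  proof (intro tendsto_add tendsto_diff)
    show "(\<lambda>j. LINT z:Theta R T|lborel. G z * D j z) \<longlonglongrightarrow> (LINT z:past P|lborel. G z)"
      using lim_G(1) by (simp add: D_def)
    show "(\<lambda>j. LINT z:Theta R T|lborel. a z * D j z) \<longlonglongrightarrow> (LINT z:past P|lborel. a z)"
      using lim_a(1) by (simp add: D_def)
  qed (use lim_\<psi> in \<open>simp add: x0_def y0_def\<close>)
  have lim2: "(\<lambda>j. LINT z:Theta R T|lborel. w z * K j z) \<longlonglongrightarrow> 2 * w P"
    using lim_w by (simp add: K_def)
  have "2 * w P = (LINT z:past P|lborel. G z)
      + (LINT r:{fst P - snd P..fst P + snd P}|lborel. r powr m * \<psi> r) - (LINT z:past P|lborel. a z)"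
    by (rule LIMSEQ_unique[OF lim2 lim1])
  moreover have "(LINT z:past P|lborel. G z - a z) = (LINT z:past P|lborel. G z) - (LINT z:past P|lborel. a z)"
    using Gc ac past_subset_Theta[OF P(1,3)] compact_past
    by (intro set_integral_diff(2) set_integrable_compact) (auto intro: continuous_on_subset)
  ultimately show ?thesis by (simp add: w_def G_def a_def)
qed

section \<open>Comparison for the integral equation\<close>

lemma set_integral_const_compact:
  fixes S :: "'a::euclidean_space set"
  assumes "compact S"
  shows "(LINT z:S|lborel. (c::real)) = c * measure lborel S"
proof -
  have "emeasure lborel S < \<infinity>" using emeasure_compact_finite[OF assms] by simp
  then show ?thesis by (simp add: set_lebesgue_integral_def)
qed

lemma set_integrable_const_indicator:
  fixes S :: "'a::euclidean_space set"
  assumes S: "compact S" and A: "A \<in> sets borel"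
  shows "set_integrable lborel S (\<lambda>z. c * indicator A z :: real)"
    and "(LINT z:S|lborel. c * indicator A z) = c * measure lborel (S \<inter> A)"
proof -
  have Sb: "S \<in> sets borel" using compact_imp_closed[OF S] by (rule borel_closed)
  have "emeasure lborel (S \<inter> A) \<le> emeasure lborel S"
    by (rule emeasure_mono) (use Sb in auto)
  then have fin: "emeasure lborel (S \<inter> A) < \<infinity>"
    using emeasure_compact_finite[OF S] by (simp add: le_less_trans)
  have eq: "(\<lambda>z. indicator S z *\<^sub>R (c * indicator A z)) = (\<lambda>z. indicator (S \<inter> A) z * c)"
    by (auto simp: indicator_def)
  show "set_integrable lborel S (\<lambda>z. c * indicator A z :: real)"
    unfolding set_integrable_def eq
    by (intro integrable_mult_left integrable_real_indicator) (use fin Sb A in auto)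
  show "(LINT z:S|lborel. c * indicator A z) = c * measure lborel (S \<inter> A)"
    unfolding set_lebesgue_integral_def eq by simp
qed

lemma set_integral_mono_past:
  assumes "set_integrable lborel (past P) f" "\<And>z. z \<in> past P \<Longrightarrow> 0 \<le> f z" "Q \<in> past P"
  shows "(LINT z:past Q|lborel. f z) \<le> (LINT z:past P|lborel. (f z :: real))"
  unfolding set_lebesgue_integral_def
proof (rule integral_mono')
  show "integrable lborel (\<lambda>z. indicat_real (past P) z *\<^sub>R f z)"
    using assms(1) by (simp add: set_integrable_def)
qed (use assms past_trans[OF assms(3)] in \<open>auto simp: indicator_def\<close>)

text \<open>One step of a bootstrap: if \<open>w\<close> may be negative in \<open>past P\<close> only on \<open>A\<close>, and is there at least \<open>- \<mu>\<close>,
  then \<open>w P\<close> is at least a quarter of the contribution of data and positive source, up to an error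
  proportional to \<open>\<mu>\<close> and to the area of \<open>past P \<inter> A\<close>.

  The integral equation first gives an upper bound \<open>c\<close> for \<open>w\<close> on \<open>past P\<close>: discarding the
  terms of favourable sign, each value is, up to the error, at most half of the data and positive source
  seen from \<open>P\<close>, because backward triangles are nested. Inserted in the potential term, this upper bound costs at most
  \<open>c\<close>, as the area of the triangle is at most \<open>2 * \<tau>^2\<close>, so half of the main term survives.\<close>

lemma duhamel_lower_bound:
  fixes w d G q :: "real \<times> real \<Rightarrow> real"
  assumes \<tau>: "\<tau> > 0" "snd P0 = \<tau>"
    and cont: "continuous_on (past P0) w" "continuous_on (past P0) G" "continuous_on (past P0) q"
    and eq: "\<And>P. P \<in> past P0 \<Longrightarrow> 2 * w P = d P + (LINT z:past P|lborel. G z - q z * w z)"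
    and d: "\<And>P. P \<in> past P0 \<Longrightarrow> 0 \<le> d P" "\<And>P Q. P \<in> past P0 \<Longrightarrow> Q \<in> past P \<Longrightarrow> d Q \<le> d P"
    and q: "\<And>z. z \<in> past P0 \<Longrightarrow> 0 \<le> q z" "\<And>z. z \<in> past P0 \<Longrightarrow> q z \<le> 1 / (2 * \<tau>\<^sup>2)"
    and L: "L \<ge> 0" "\<And>z. z \<in> past P0 \<Longrightarrow> - L * max 0 (- w z) \<le> G z"
    and P: "P \<in> past P0" and A: "A \<in> sets borel" and "\<mu> \<ge> 0"
    and lower: "\<And>z. z \<in> past P \<Longrightarrow> - \<mu> * indicator A z \<le> w z"
  shows "(d P + (LINT z:past P|lborel. max 0 (G z))) / 2
      - (L + 1 / (2 * \<tau>\<^sup>2)) * \<mu> * measure lborel (past P \<inter> A) \<le> 2 * w P"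
proof -
  define \<kappa> where "\<kappa> = 1 / (2 * \<tau>\<^sup>2)"
  define a where "a = measure lborel (past P \<inter> A)"
  define N where "N = d P + (LINT z:past P|lborel. max 0 (G z))"
  have \<kappa>: "\<kappa> > 0" using \<tau> by (simp add: \<kappa>_def)
  have sub: "past Q \<subseteq> past P0" if "Q \<in> past P0" for Q using past_trans[OF that] .
  have int: "set_integrable lborel (past Q) (\<lambda>z. max 0 (G z))"
    "set_integrable lborel (past Q) (\<lambda>z. G z - q z * w z)" if "Q \<in> past P0" for Q
    using that sub[OF that] cont
    by (auto intro!: set_integrable_compact compact_past continuous_intros intro: continuous_on_subset)
  have a: "a \<ge> 0" by (simp add: a_def)
  have upper: "w Q \<le> (N + \<kappa> * \<mu> * a) / 2" if Q: "Q \<in> past P" for Q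
  proof -
    have Q0: "Q \<in> past P0" using Q sub[OF P] by blast
    have QP: "past Q \<subseteq> past P" using past_trans[OF Q] .
    have "(LINT z:past Q|lborel. G z - q z * w z) \<le> (LINT z:past Q|lborel. max 0 (G z) + (\<kappa> * \<mu>) * indicator A z)"
    proof (rule set_integral_mono)
      fix z assume "z \<in> past Q"
      then have z: "z \<in> past P" "z \<in> past P0" using QP sub[OF P] by auto
      have "- w z \<le> \<mu> * indicator A z" using lower[OF z(1)] by simp
      then have "q z * (- w z) \<le> q z * (\<mu> * indicator A z)" using q(1)[OF z(2)] by (rule mult_left_mono)
      also have "\<dots> \<le> \<kappa> * (\<mu> * indicator A z)"
        using q(2)[OF z(2)] \<open>\<mu> \<ge> 0\<close> by (intro mult_right_mono) (auto simp: \<kappa>_def)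
      finally show "G z - q z * w z \<le> max 0 (G z) + (\<kappa> * \<mu>) * indicator A z" by (simp add: mult.assoc)
    next
      show "set_integrable lborel (past Q) (\<lambda>z. max 0 (G z) + (\<kappa> * \<mu>) * indicator A z)"
        by (rule set_integral_add(1)[OF int(1)[OF Q0] set_integrable_const_indicator(1)[OF compact_past A]])
    qed (rule int(2)[OF Q0])
    also have "\<dots> = (LINT z:past Q|lborel. max 0 (G z)) + (\<kappa> * \<mu>) * measure lborel (past Q \<inter> A)"
      using set_integrable_const_indicator[OF compact_past A] int(1)[OF Q0] by simp
    also have "(LINT z:past Q|lborel. max 0 (G z)) \<le> (LINT z:past P|lborel. max 0 (G z))"
      by (rule set_integral_mono_past[OF int(1)[OF P] _ Q]) auto
    also have "measure lborel (past Q \<inter> A) \<le> a"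
      unfolding a_def
    proof (rule measure_mono_fmeasurable)
      show "past P \<inter> A \<in> fmeasurable lborel"
        using A by (intro fmeasurable_Int_fmeasurable compact_past fmeasurable_compact) auto
    qed (use QP A past_borel in auto)
    then have "(\<kappa> * \<mu>) * measure lborel (past Q \<inter> A) \<le> (\<kappa> * \<mu>) * a"
      using \<kappa> \<open>\<mu> \<ge> 0\<close> by (intro mult_left_mono) auto
    finally have "(LINT z:past Q|lborel. G z - q z * w z) \<le> (LINT z:past P|lborel. max 0 (G z)) + (\<kappa> * \<mu>) * a"
      by simp
    with eq[OF Q0] d(2)[OF P Q] show ?thesis by (simp add: N_def)
  qed
  define c where "c = (N + \<kappa> * \<mu> * a) / 2"
  have "0 \<le> (LINT z:past P|lborel. max 0 (G z))"
    unfolding set_lebesgue_integral_def by (intro integral_nonneg_AE) (auto simp: indicator_def)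
  then have N: "N \<ge> 0" using d(1)[OF P] by (simp add: N_def)
  have c: "c \<ge> 0" using N \<kappa> \<open>\<mu> \<ge> 0\<close> a by (simp add: c_def)
  have "(LINT z:past P|lborel. max 0 (G z)) - L * \<mu> * a - \<kappa> * c * measure lborel (past P)
     = (LINT z:past P|lborel. max 0 (G z) - (L * \<mu>) * indicator A z - \<kappa> * c)"
  proof -
    note I = int(1)[OF P] set_integrable_const_indicator(1)[OF compact_past A, of P "L * \<mu>"]
    show ?thesis
      unfolding a_def set_integral_diff(2)[OF set_integral_diff(1)[OF I]
          set_integrable_compact[OF compact_past continuous_on_const]] set_integral_diff(2)[OF I]
        set_integrable_const_indicator(2)[OF compact_past A] set_integral_const_compact[OF compact_past]
      by (rule refl)
  qed
  also have "\<dots> \<le> (LINT z:past P|lborel. G z - q z * w z)"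
  proof (rule set_integral_mono)
    fix z assume zP: "z \<in> past P"
    then have z: "z \<in> past P0" using sub[OF P] by auto
    have "- w z \<le> \<mu> * indicator A z" using lower[OF zP] by linarith
    then have "max 0 (- w z) \<le> \<mu> * indicator A z"
      by (intro max.boundedI mult_nonneg_nonneg indicator_pos_le \<open>\<mu> \<ge> 0\<close>)
    then have L1: "L * max 0 (- w z) \<le> L * (\<mu> * indicator A z)" using L(1) by (rule mult_left_mono)
    have L2: "0 \<le> L * max 0 (- w z)" by (rule mult_nonneg_nonneg[OF L(1)]) simp
    have "- (L * max 0 (- w z)) \<le> G z" using L(2)[OF z] by (simp only: minus_mult_left)
    then have "max 0 (G z) \<le> G z + L * max 0 (- w z)"
      using L2 by (intro max.boundedI) simp_all
    with L1 have 1: "max 0 (G z) - (L * \<mu>) * indicator A z \<le> G z"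
      unfolding mult.assoc by linarith
    have "q z * w z \<le> q z * c" using upper[OF zP] q(1)[OF z] by (intro mult_left_mono) (auto simp: c_def)
    also have "\<dots> \<le> \<kappa> * c" using q(2)[OF z] c by (intro mult_right_mono) (auto simp: \<kappa>_def)
    finally have 2: "q z * w z \<le> \<kappa> * c" .
    show "max 0 (G z) - (L * \<mu>) * indicator A z - \<kappa> * c \<le> G z - q z * w z"
      by (rule diff_mono[OF 1 2])
  next
    show "set_integrable lborel (past P) (\<lambda>z. max 0 (G z) - (L * \<mu>) * indicator A z - \<kappa> * c)"
      by (rule set_integral_diff(1)[OF set_integral_diff(1)[OF int(1)[OF P]
            set_integrable_const_indicator(1)[OF compact_past A]]
            set_integrable_compact[OF compact_past continuous_on_const]])
  qed (rule int(2)[OF P])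
  finally have 1: "N - L * \<mu> * a - \<kappa> * c * measure lborel (past P) \<le> 2 * w P"
    using eq[OF P] by (simp add: N_def)
  have "0 \<le> snd P" "snd P \<le> \<tau>" using P \<tau> by (auto simp: past_def)
  then have "measure lborel (past P) \<le> 2 * (snd P)\<^sup>2" "(snd P)\<^sup>2 \<le> \<tau>\<^sup>2"
    by (auto intro: measure_past_le power_mono)
  then have "measure lborel (past P) \<le> 2 * \<tau>\<^sup>2" by linarith
  then have "\<kappa> * c * measure lborel (past P) \<le> \<kappa> * c * (2 * \<tau>\<^sup>2)"
    using \<kappa> c by (intro mult_left_mono) auto
  also have "\<dots> = c" using \<tau> by (simp add: \<kappa>_def)
  finally have 2: "\<kappa> * c * measure lborel (past P) \<le> c" .
  have "N / 2 - (L + \<kappa>) * \<mu> * a = N - L * \<mu> * a - c - \<kappa> * \<mu> * a / 2"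
    by (simp add: c_def field_simps)
  also have "\<dots> \<le> N - L * \<mu> * a - c" using \<kappa> \<open>\<mu> \<ge> 0\<close> a by simp
  also have "\<dots> \<le> N - L * \<mu> * a - \<kappa> * c * measure lborel (past P)"
    by (rule diff_left_mono[OF 2])
  also note 1
  finally have "N / 2 - (L + \<kappa>) * \<mu> * a \<le> 2 * w P" .
  then show ?thesis by (simp add: N_def \<kappa>_def a_def)
qed

text \<open>Nonnegativity is propagated through thin strips in time. On the first strip where it could fail, the
  set \<open>A\<close> of the preceding lemma is contained in this strip; its area is so small that the error is less
  than the assumed negative minimum in absolute value. Once \<open>w\<close> is nonnegative, the preceding lemma with
  \<open>\<mu> = 0\<close> gives the lower bound.\<close>

lemma duhamel_comparison:
  fixes w d G q :: "real \<times> real \<Rightarrow> real"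
  assumes \<tau>: "\<tau> > 0" "snd P0 = \<tau>"
    and cont: "continuous_on (past P0) w" "continuous_on (past P0) G" "continuous_on (past P0) q"
    and eq: "\<And>P. P \<in> past P0 \<Longrightarrow> 2 * w P = d P + (LINT z:past P|lborel. G z - q z * w z)"
    and d: "\<And>P. P \<in> past P0 \<Longrightarrow> 0 \<le> d P" "\<And>P Q. P \<in> past P0 \<Longrightarrow> Q \<in> past P \<Longrightarrow> d Q \<le> d P"
    and q: "\<And>z. z \<in> past P0 \<Longrightarrow> 0 \<le> q z" "\<And>z. z \<in> past P0 \<Longrightarrow> q z \<le> 1 / (2 * \<tau>\<^sup>2)"
    and L: "L \<ge> 0" "\<And>z. z \<in> past P0 \<Longrightarrow> - L * max 0 (- w z) \<le> G z"
    and P: "P \<in> past P0"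
  shows "0 \<le> w P" and "d P + (LINT z:past P|lborel. max 0 (G z)) \<le> 4 * w P"
proof -
  have step: "(d P + (LINT z:past P|lborel. max 0 (G z))) / 2
      - (L + 1 / (2 * \<tau>\<^sup>2)) * \<mu> * measure lborel (past P \<inter> A) \<le> 2 * w P"
    if "P \<in> past P0" "A \<in> sets borel" "\<mu> \<ge> 0" "\<And>z. z \<in> past P \<Longrightarrow> - \<mu> * indicator A z \<le> w z"
    for P A \<mu>
    by (rule duhamel_lower_bound[where L = L and d = d, OF \<tau> cont]; fact eq d q L that)
  define \<kappa> where "\<kappa> = L + 1 / (2 * \<tau>\<^sup>2)"
  have \<kappa>: "\<kappa> > 0" using \<tau> L by (simp add: \<kappa>_def add_nonneg_pos)
  \<comment> \<open>A strip of height \<open>h\<close> has area at most \<open>2 * \<tau> * h\<close> inside the triangle, so its error term is at most \<open>\<mu>\<close>, whereas a contradiction requires less than \<open>2 * \<mu>\<close>.\<close>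
  define h where "h = 1 / (2 * \<tau> * \<kappa>)"
  have h: "h > 0" using \<kappa> \<tau> by (simp add: h_def)
  have pos: "\<forall>P \<in> past P0. snd P < real j * h \<longrightarrow> 0 \<le> w P" for j
  proof (induction j)
    case 0
    then show ?case by (auto simp: past_def)
  next
    case (Suc j)
    define S where "S = past P0 \<inter> {z. snd z \<le> real (Suc j) * h}"
    have S: "compact S" unfolding S_def
      by (intro compact_Int_closed compact_past closed_Collect_le continuous_intros)
    show ?case
    proof (cases "S = {}")
      case False
      have "continuous_on S w" by (rule continuous_on_subset[OF cont(1)]) (simp add: S_def)
      then obtain Q where Q: "Q \<in> S" and Qmin: "\<And>z. z \<in> S \<Longrightarrow> w Q \<le> w z"
        using continuous_attains_inf[OF S False] by blast
      have "0 \<le> w Q"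
      proof (rule ccontr)
        assume neg: "\<not> 0 \<le> w Q"
        define A where "A = {z::real\<times>real. real j * h \<le> snd z}"
        have A: "A \<in> sets borel" unfolding A_def
          by (intro borel_closed closed_Collect_le continuous_intros)
        have Q0: "Q \<in> past P0" using Q by (simp add: S_def)
        have "past Q \<subseteq> S"
        proof
          fix z assume z: "z \<in> past Q"
          then have "snd z \<le> snd Q" by (auto simp: past_def)
          moreover have "snd Q \<le> real (Suc j) * h" using Q by (simp add: S_def)
          ultimately have "snd z \<le> real (Suc j) * h" by (rule order_trans)
          with z past_trans[OF Q0] show "z \<in> S" by (auto simp: S_def)
        qed
        then have low: "- (- w Q) * indicator A z \<le> w z" if "z \<in> past Q" for z
        proof (cases "z \<in> A")
          case True
          moreover have "z \<in> S" using that \<open>past Q \<subseteq> S\<close> by blast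
          ultimately show ?thesis using Qmin[of z] by simp
        next
          case False
          then have "snd z < real j * h" by (simp add: A_def)
          moreover have "z \<in> past P0" using past_trans[OF Q0] that by blast
          ultimately have "0 \<le> w z" using Suc.IH by blast
          then show ?thesis using False by simp
        qed
        have "0 \<le> - w Q" using neg by simp
        from step[OF Q0 A this low]
        have 1: "(d Q + (LINT z:past Q|lborel. max 0 (G z))) / 2 - \<kappa> * (- w Q) * measure lborel (past Q \<inter> A) \<le> 2 * w Q"
          unfolding \<kappa>_def .
        have "0 \<le> (LINT z:past Q|lborel. max 0 (G z))"
          unfolding set_lebesgue_integral_def by (intro integral_nonneg_AE) (auto simp: indicator_def)
        then have "0 \<le> (d Q + (LINT z:past Q|lborel. max 0 (G z))) / 2" using d(1)[OF Q0] by simp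
        from order_trans[OF diff_right_mono[OF this] 1]
        have 2: "2 * (- w Q) \<le> \<kappa> * (- w Q) * measure lborel (past Q \<inter> A)" by simp
        have "measure lborel (past Q \<inter> A) \<le> measure lborel (cbox (fst Q - \<tau>, real j * h) (fst Q + \<tau>, real (Suc j) * h))"
        proof (rule measure_mono_fmeasurable)
          have "snd Q \<le> \<tau>" using Q0 \<tau> by (auto simp: past_def)
          then show "past Q \<inter> A \<subseteq> cbox (fst Q - \<tau>, real j * h) (fst Q + \<tau>, real (Suc j) * h)"
            using Q by (auto simp: A_def past_def S_def)
        qed (use A past_borel in auto)
        also have "\<dots> = 2 * \<tau> * h"
          using \<tau> h by (subst measure_lborel_rectangle) (auto simp: algebra_simps)
        finally have "\<kappa> * (- w Q) * measure lborel (past Q \<inter> A) \<le> \<kappa> * (- w Q) * (2 * \<tau> * h)"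
          using \<kappa> neg by (intro mult_left_mono mult_nonneg_nonneg) auto
        also have "\<dots> = - w Q" using \<kappa> \<tau> by (simp add: h_def)
        finally show False using 2 neg by simp
      qed
      show ?thesis
      proof (intro ballI impI)
        fix P assume "P \<in> past P0" "snd P < real (Suc j) * h"
        then have "w Q \<le> w P" by (intro Qmin) (simp add: S_def)
        with \<open>0 \<le> w Q\<close> show "0 \<le> w P" by simp
      qed
    qed (auto simp: S_def)
  qed
  have nonneg: "0 \<le> w z" if "z \<in> past P0" for z
  proof -
    obtain j where "real j > snd z / h" using reals_Archimedean2 by blast
    then have "snd z < real j * h" using h by (simp add: field_simps)
    then show ?thesis using pos[of j] that by blast
  qed
  show "0 \<le> w P" by (rule nonneg[OF P])
  have "\<And>z. z \<in> past P \<Longrightarrow> - 0 * indicator {} z \<le> w z"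
    using nonneg past_trans[OF P] by auto
  from step[OF P _ _ this] show "d P + (LINT z:past P|lborel. max 0 (G z)) \<le> 4 * w P"
    by simp
qed

section \<open>Doubling of lower bounds\<close>

text \<open>If \<open>w \<ge> b\<close> in the future of \<open>(r, s)\<close>, then at each point in the future of \<open>(r, s + h)\<close> the backward
  triangle contains a square of area \<open>h^2 / 4\<close> on which \<open>w powr p \<ge> b powr p\<close>, so that
  \<open>w \<ge> \<kappa> * b powr p * h^2 / 4\<close>. This is \<open>2 * b\<close> if \<open>\<kappa> * b powr (p - 1) * h^2 = 8\<close>. As \<open>b\<close> runs through
  \<open>B * 2 ^ j\<close>, the values of \<open>h\<close> form a geometric sequence with ratio \<open>\<theta>\<close>. If their sum is less than
  \<open>\<tau> / 2\<close>, all these bounds apply to the continuous function \<open>w\<close> at \<open>(r, \<tau>)\<close>, which is absurd.\<close>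

lemma doubling_bound:
  fixes w :: "real \<times> real \<Rightarrow> real" and r \<tau> p \<kappa> B :: real
  defines "\<theta> \<equiv> 2 powr (- (p - 1) / 2)"
  assumes \<tau>: "\<tau> > 0" and p: "p > 1" and \<kappa>: "\<kappa> > 0" and B: "B > 0"
    and cont: "continuous_on (past (r, \<tau>)) w" and nonneg: "\<And>z. z \<in> past (r, \<tau>) \<Longrightarrow> 0 \<le> w z"
    and rec: "\<And>P. P \<in> past (r, \<tau>) \<Longrightarrow> \<kappa> * (LINT z:past P|lborel. w z powr p) \<le> w P"
    and base: "\<And>P. P \<in> past (r, \<tau>) \<Longrightarrow> (r, \<tau> / 2) \<in> past P \<Longrightarrow> B \<le> w P"
  shows "\<kappa> * B powr (p - 1) * \<tau>\<^sup>2 \<le> 32 / (1 - \<theta>)\<^sup>2"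
proof (rule ccontr)
  assume "\<not> \<kappa> * B powr (p - 1) * \<tau>\<^sup>2 \<le> 32 / (1 - \<theta>)\<^sup>2"
  then have big: "32 / (1 - \<theta>)\<^sup>2 < \<kappa> * B powr (p - 1) * \<tau>\<^sup>2" by simp
  define X where "X = \<kappa> * B powr (p - 1)"
  have X: "X > 0" using \<kappa> B by (simp add: X_def)
  have \<theta>: "0 < \<theta>" "\<theta> < 1" using p by (auto simp: \<theta>_def powr_less_one)
  define h where "h j = sqrt (8 / X) * \<theta> ^ j" for j :: nat
  have h: "h j > 0" for j using X \<theta> by (simp add: h_def)
  \<comment> \<open>From the instant \<open>s j\<close> on, the lower bound \<open>B * 2 ^ j\<close> holds.\<close>
  define s where "s j = \<tau> / 2 + (\<Sum>i<j. h i)" for j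
  have s0: "s j \<ge> 0" for j
    using \<tau> sum_nonneg[of "{..<j}" h] h by (simp add: s_def less_imp_le)
  have "(sqrt (8 / X) / (1 - \<theta>))\<^sup>2 = 8 / X / (1 - \<theta>)\<^sup>2"
    using X by (simp add: power_divide)
  also have "\<dots> = 32 / (1 - \<theta>)\<^sup>2 / X / 4" by simp
  also have "32 / (1 - \<theta>)\<^sup>2 / X < \<tau>\<^sup>2"
    by (subst pos_divide_less_eq[OF X]) (use big in \<open>simp add: X_def mult.commute mult.left_commute\<close>)
  then have "32 / (1 - \<theta>)\<^sup>2 / X / 4 < \<tau>\<^sup>2 / 4" by (rule divide_strict_right_mono) simp
  also have "\<dots> = (\<tau> / 2)\<^sup>2" by (simp add: power_divide)
  finally have H: "sqrt (8 / X) / (1 - \<theta>) < \<tau> / 2"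
    by (rule power_less_imp_less_base) (use \<tau> in simp)
  have s_le: "s j \<le> \<tau>" for j
  proof -
    have "(\<Sum>i<j. h i) = sqrt (8 / X) * ((1 - \<theta> ^ j) / (1 - \<theta>))"
      using \<theta> sum_gp_strict[of \<theta> j] by (simp add: h_def sum_distrib_left[symmetric])
    also have "\<dots> \<le> sqrt (8 / X) * (1 / (1 - \<theta>))"
      using \<theta> X by (intro mult_left_mono divide_right_mono) auto
    finally have "(\<Sum>i<j. h i) \<le> sqrt (8 / X) / (1 - \<theta>)" by simp
    then have "(\<Sum>i<j. h i) \<le> \<tau> / 2" using H by (rule order_trans[OF _ less_imp_le])
    then show ?thesis by (simp add: s_def)
  qed
  have cont_p: "continuous_on (past (r, \<tau>)) (\<lambda>z. w z powr p)"
    using nonneg p by (intro continuous_on_powr' cont continuous_intros) auto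
  have main: "B * 2 ^ j \<le> w P" if "P \<in> past (r, \<tau>)" "(r, s j) \<in> past P" for j P
    using that
  proof (induction j arbitrary: P)
    case 0
    then show ?case using base by (simp add: s_def)
  next
    case (Suc j)
    \<comment> \<open>A square of side \<open>h j / 2\<close> between the future of \<open>(r, s j)\<close> and the past of \<open>(r, s (Suc j))\<close>.\<close>
    define C where "C = cbox (r - h j / 4, s j + h j / 4) (r + h j / 4, s j + 3 * h j / 4)"
    define b where "b = B * 2 ^ j"
    have b: "b > 0" using B by (simp add: b_def)
    have PP: "past P \<subseteq> past (r, \<tau>)" using past_trans[OF Suc.prems(1)] .
    have CP: "C \<subseteq> past P"
    proof
      fix z assume "z \<in> C"
      then have "z \<in> past (r, s (Suc j))"
        using h[of j] s0[of j] by (cases z) (auto simp: C_def past_def s_def abs_le_iff)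
      then show "z \<in> past P" using past_trans[OF Suc.prems(2)] by auto
    qed
    have Cw: "b \<le> w z" if "z \<in> C" for z
      unfolding b_def
    proof (rule Suc.IH)
      show "z \<in> past (r, \<tau>)" using that CP PP by auto
      show "(r, s j) \<in> past z"
        using that h[of j] s0[of j] by (cases z) (auto simp: C_def past_def abs_le_iff)
    qed
    have "b powr p * (h j)\<^sup>2 / 4 = (LINT z:C|lborel. b powr p)"
      using h[of j]
      by (subst set_integral_const_compact)
         (auto simp: C_def measure_lborel_rectangle power2_eq_square field_simps)
    also have "\<dots> \<le> (LINT z:C|lborel. w z powr p)"
    proof (rule set_integral_mono)
      show "set_integrable lborel C (\<lambda>z. w z powr p)"
        using CP PP by (intro set_integrable_compact continuous_on_subset[OF cont_p]) (auto simp: C_def)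
      show "set_integrable lborel C (\<lambda>z. b powr p)"
        by (intro set_integrable_compact continuous_on_const) (auto simp: C_def)
    qed (use Cw b p in \<open>auto intro!: powr_mono2\<close>)
    also have "\<dots> \<le> (LINT z:past P|lborel. w z powr p)"
      unfolding set_lebesgue_integral_def
    proof (rule integral_mono')
      show "integrable lborel (\<lambda>z. indicat_real (past P) z *\<^sub>R w z powr p)"
        using set_integrable_compact[OF compact_past continuous_on_subset[OF cont_p PP]]
        by (simp add: set_integrable_def)
    qed (use CP in \<open>auto simp: indicator_def\<close>)
    finally have "\<kappa> * (b powr p * (h j)\<^sup>2 / 4) \<le> \<kappa> * (LINT z:past P|lborel. w z powr p)"
      using \<kappa> by (intro mult_left_mono) auto
    also have "\<dots> \<le> w P" by (rule rec[OF Suc.prems(1)])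
    finally have 1: "\<kappa> * (b powr p * (h j)\<^sup>2 / 4) \<le> w P" .
    have "b powr (p - 1) * (\<theta> ^ j)\<^sup>2 = B powr (p - 1)"
    proof -
      have "b powr (p - 1) = B powr (p - 1) * (2 powr (p - 1)) ^ j"
        using B by (simp add: b_def powr_mult powr_powr powr_power mult.commute flip: powr_realpow)
      moreover have "(\<theta> ^ j)\<^sup>2 = (2 powr (- (p - 1))) ^ j"
        by (simp add: \<theta>_def powr_power mult.commute flip: power_mult)
      ultimately have "b powr (p - 1) * (\<theta> ^ j)\<^sup>2 = B powr (p - 1) * (2 powr (p - 1) * 2 powr (- (p - 1))) ^ j"
        by (simp add: power_mult_distrib)
      also have "2 powr (p - 1) * 2 powr (- (p - 1)) = (1::real)" by (simp flip: powr_add)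
      finally show ?thesis by simp
    qed
    then have "X * (h j)\<^sup>2 = 8 * (\<theta> ^ j)\<^sup>2" "\<kappa> * b powr (p - 1) * (\<theta> ^ j)\<^sup>2 = X"
      using X by (auto simp: h_def power_mult_distrib X_def)
    moreover have "b powr p = b powr (p - 1) * b" using b powr_add[of b "p - 1" 1] by simp
    ultimately have "\<kappa> * b powr (p - 1) * (h j)\<^sup>2 = 8"
      using X \<theta> by (simp add: h_def power_mult_distrib field_simps)
    then have "\<kappa> * (b powr p * (h j)\<^sup>2 / 4) = 2 * b"
      using \<open>b powr p = b powr (p - 1) * b\<close> by (simp add: algebra_simps)
    with 1 show ?case by (simp add: b_def)
  qed
  have "B * 2 ^ j \<le> w (r, \<tau>)" for j
    using s_le[of j] s0[of j] \<tau> by (intro main) (auto simp: past_def)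
  moreover obtain j where "w (r, \<tau>) / B < 2 ^ j" using real_arch_pow[of 2] by auto
  ultimately show False using B by (simp add: field_simps not_less[symmetric])
qed

section \<open>The lifespan estimate\<close>

lemma C1_lipschitz_at_zero:
  fixes F :: "real \<Rightarrow> real"
  assumes "F C1_differentiable_on UNIV" "F 0 = 0"
  shows "\<exists>L\<ge>0. \<forall>v. \<bar>v\<bar> \<le> U \<longrightarrow> \<bar>F v\<bar> \<le> L * \<bar>v\<bar>"
proof -
  obtain D where D: "\<And>x. (F has_real_derivative D x) (at x)" "continuous_on UNIV D"
    using assms(1) by (auto simp: C1_differentiable_on_def has_real_derivative_iff_has_vector_derivative)
  have "bounded (D ` {-U..U})"
    using D(2) by (intro compact_imp_bounded compact_continuous_image) (auto intro: continuous_on_subset)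
  then obtain L where L: "L > 0" "\<And>x. x \<in> {-U..U} \<Longrightarrow> norm (D x) \<le> L"
    by (auto simp: bounded_pos)
  have "\<bar>F v\<bar> \<le> L * \<bar>v\<bar>" if "\<bar>v\<bar> \<le> U" for v
  proof -
    have "norm (F v - F 0) \<le> L * norm (v - 0)"
      by (rule field_differentiable_bound[of "{-U..U}" F D L])
         (use D(1) L(2) that in \<open>auto intro: has_field_derivative_at_within\<close>)
    with assms(2) show ?thesis by simp
  qed
  with L show ?thesis by (intro exI[of _ L]) auto
qed

text \<open>The integral equation is studied in the backward triangle with base from \<open>\<alpha> = R + M * \<tau>\<close> to
  \<open>\<beta> = \<alpha> + 2 * \<tau>\<close>. Because \<open>R \<le> \<tau>\<close>, both ends are comparable with \<open>\<tau>\<close>, and the powers of \<open>\<tau>\<close> that come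
  from the weight \<open>r powr m\<close> in \<open>\<kappa>\<close> and in \<open>B\<close> cancel in \<open>\<kappa> * B powr (p - 1)\<close>.\<close>

lemma wave_blowup_estimate:
  fixes n :: nat and R A p k \<epsilon> \<tau> T M :: real and F V \<psi> :: "real \<Rightarrow> real"
  defines "m \<equiv> (real n - 1) / 2" and "\<theta> \<equiv> 2 powr (- (p - 1) / 2)"
  assumes n: "n \<ge> 1" and R: "R > 0"
    and F: "F C1_differentiable_on UNIV" "F 0 = 0" "\<And>u. u \<ge> 0 \<Longrightarrow> F u \<ge> A * u powr p"
    and A: "A > 0" and p: "p > 1"
    and V: "continuous_on {R<..} V" "\<And>r. r > R \<Longrightarrow> V r \<le> 0"
    and k: "0 \<le> k" and \<epsilon>: "\<epsilon> > 0"
    and \<psi>: "continuous_on {R<..} \<psi>" "\<And>r. r > R \<Longrightarrow> \<psi> r \<ge> \<epsilon> * r powr (- k - 1)"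
    and sol: "is_solution n R T (\<lambda>r u. F u - V r * u) \<psi> u"
    and \<tau>: "R \<le> \<tau>" "\<tau> < T"
    and M: "M \<ge> 1" "2 * (m * (m - 1)) \<le> M\<^sup>2"
  shows "A / 4 * ((1 / 3) powr m * ((M + 3) powr (- k - 1) / 4)) powr (p - 1)
     * (\<epsilon> powr (p - 1) * \<tau> powr (2 - k * (p - 1))) \<le> 32 / (1 - \<theta>)\<^sup>2"
proof -
  have \<tau>0: "\<tau> > 0" using R \<tau> by simp
  have m: "m \<ge> 0" using n by (simp add: m_def)
  define \<alpha> \<beta> where "\<alpha> = R + M * \<tau>" and "\<beta> = \<alpha> + 2 * \<tau>"
  define P0 where "P0 = (\<alpha> + \<tau>, \<tau>)"
  have M\<tau>: "\<tau> \<le> M * \<tau>" using M(1) \<tau>0 by simp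
  have \<alpha>: "M * \<tau> \<le> \<alpha>" "\<tau> \<le> \<alpha>" "R < \<alpha>" "0 < \<alpha>"
  proof -
    show "M * \<tau> \<le> \<alpha>" using R by (simp add: \<alpha>_def)
    then show "\<tau> \<le> \<alpha>" using M\<tau> by linarith
    show "R < \<alpha>" using M\<tau> \<tau>0 unfolding \<alpha>_def by linarith
    then show "0 < \<alpha>" using R by linarith
  qed
  have \<beta>: "\<beta> \<le> (M + 3) * \<tau>" "\<beta> \<le> 3 * \<alpha>" "0 < \<beta>"
    using \<alpha> \<tau>0 \<tau>(1) by (auto simp: \<beta>_def \<alpha>_def algebra_simps)
  have dom: "\<alpha> \<le> fst z - snd z" "\<alpha> \<le> fst z" "fst z \<le> \<beta>" "fst z + snd z \<le> \<beta>" "0 \<le> snd z" "snd z \<le> \<tau>" "R < fst z" "0 < fst z"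
    if "z \<in> past P0" for z
    using that \<alpha> R by (auto simp: P0_def past_def \<beta>_def)
  have subTheta: "past P0 \<subseteq> Theta R T"
    by (rule past_subset_Theta) (use \<alpha> \<tau> in \<open>auto simp: P0_def\<close>)
  define w where "w z = fst z powr m * u z" for z
  define d where "d P = (LINT r:{fst P - snd P..fst P + snd P}|lborel. r powr m * \<psi> r)" for P :: "real \<times> real"
  \<comment> \<open>Only the positive part of the potential works against positivity. The negative part, which occurs for \<open>n = 2\<close>, is counted as a source.\<close>
  define q where "q z = max 0 (m * (m - 1)) / (fst z)\<^sup>2" for z :: "real \<times> real"
  define N where "N = max 0 (- (m * (m - 1)))"
  define G where "G z = fst z powr m * (F (u z) - V (fst z) * u z) + N / (fst z)\<^sup>2 * w z" for z
  have uc: "continuous_on (past P0) u"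
    using sol subTheta by (auto simp: is_solution_def solution_class_def intro: continuous_on_subset)
  have rc: "continuous_on (past P0) (\<lambda>z. fst z powr e)" for e
    by (rule continuous_on_radial_powr[OF R]) (use dom in auto)
  have wc: "continuous_on (past P0) w"
    unfolding w_def by (intro continuous_on_mult rc uc)
  have Fc: "continuous_on UNIV F"
    using F(1) by (rule C1_differentiable_imp_continuous_on)
  have Vc: "continuous_on (past P0) (\<lambda>z. V (fst z))"
    by (rule continuous_on_compose2[OF V(1)]) (use dom in \<open>auto intro!: continuous_intros\<close>)
  have r0: "fst z \<noteq> 0" if "z \<in> past P0" for z using dom(8)[OF that] by simp
  have invc: "continuous_on (past P0) (\<lambda>z. c / (fst z)\<^sup>2)" for c :: real
    by (intro continuous_intros) (use r0 in auto)
  have Gc: "continuous_on (past P0) G"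
    unfolding G_def
    by (intro continuous_on_add continuous_on_mult continuous_on_diff rc uc wc Vc invc
        continuous_on_compose2[OF Fc uc]) auto
  have qc: "continuous_on (past P0) q" unfolding q_def by (rule invc)
  have gc: "continuous_on ({R<..} \<times> UNIV) (\<lambda>(r, v). F v - V r * v)"
    unfolding split_beta
    by (intro continuous_on_diff continuous_on_mult continuous_on_compose2[OF Fc] continuous_on_compose2[OF V(1)]
        continuous_on_fst continuous_on_snd continuous_on_id) auto
  have eq: "2 * w P = d P + (LINT z:past P|lborel. G z - q z * w z)" if P: "P \<in> past P0" for P
  proof -
    have "2 * w P = d P + (LINT z:past P|lborel. fst z powr m * (F (u z) - V (fst z) * u z)
        - m * (m - 1) / (fst z)\<^sup>2 * w z)"
      unfolding w_def d_def m_def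
      by (rule dalembert_formula[OF sol n R gc \<psi>(1)]) (use dom[OF P] \<alpha> \<tau> in auto)
    also have "m * (m - 1) / (fst z)\<^sup>2 = q z - N / (fst z)\<^sup>2" for z :: "real \<times> real"
      by (simp add: q_def N_def max_def)
    then have "(\<lambda>z. fst z powr m * (F (u z) - V (fst z) * u z) - m * (m - 1) / (fst z)\<^sup>2 * w z)
      = (\<lambda>z. G z - q z * w z)"
      by (simp add: G_def left_diff_distrib fun_eq_iff)
    finally show ?thesis .
  qed
  have \<psi>m: "continuous_on {R<..} (\<lambda>r. r powr m * \<psi> r)"
    by (intro continuous_intros \<psi>(1)) (use R in auto)
  have \<psi>nonneg: "0 \<le> r powr m * \<psi> r" if "r > R" for r
    using \<psi>(2)[OF that] \<epsilon> by (auto intro!: mult_nonneg_nonneg order_trans[of 0 "\<epsilon> * r powr (- k - 1)" "\<psi> r"])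
  have Rint: "R < r" if "P \<in> past P0" "r \<in> {fst P - snd P..fst P + snd P}" for P r
    using dom(1)[OF that(1)] that(2) \<alpha> by auto
  have \<psi>int: "set_integrable lborel {fst P - snd P..fst P + snd P} (\<lambda>r. r powr m * \<psi> r)"
    if "P \<in> past P0" for P
    by (intro set_integrable_compact continuous_on_subset[OF \<psi>m]) (use Rint[OF that] in auto)
  have d_nonneg: "0 \<le> d P" if "P \<in> past P0" for P
    unfolding d_def set_lebesgue_integral_def
    by (intro integral_nonneg_AE) (use \<psi>nonneg Rint[OF that] in \<open>auto simp: indicator_def\<close>)
  have d_mono: "d Q \<le> d P" if "P \<in> past P0" "Q \<in> past P" for P Q
    unfolding d_def set_lebesgue_integral_def
  proof (rule integral_mono')
    show "integrable lborel (\<lambda>r. indicat_real {fst P - snd P..fst P + snd P} r *\<^sub>R (r powr m * \<psi> r))"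
      using \<psi>int[OF that(1)] by (simp add: set_integrable_def)
    have sub: "{fst Q - snd Q..fst Q + snd Q} \<subseteq> {fst P - snd P..fst P + snd P}"
      using that(2) by (auto simp: past_def)
    show "indicat_real {fst Q - snd Q..fst Q + snd Q} r *\<^sub>R (r powr m * \<psi> r)
        \<le> indicat_real {fst P - snd P..fst P + snd P} r *\<^sub>R (r powr m * \<psi> r)" for r
      using sub \<psi>nonneg Rint[OF that(1), of r] by (auto simp: indicator_def)
    show "0 \<le> indicat_real {fst P - snd P..fst P + snd P} r *\<^sub>R (r powr m * \<psi> r)" for r
      using \<psi>nonneg Rint[OF that(1), of r] by (auto simp: indicator_def)
  qed
  have q_le: "q z \<le> 1 / (2 * \<tau>\<^sup>2)" if "z \<in> past P0" for z
  proof -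
    have "(M * \<tau>)\<^sup>2 \<le> (fst z)\<^sup>2"
      using dom(2)[OF that] \<alpha>(1) M \<tau>0 by (intro power_mono) auto
    then have "q z \<le> max 0 (m * (m - 1)) / (M * \<tau>)\<^sup>2"
      unfolding q_def using M \<tau>0 r0[OF that] by (intro divide_left_mono mult_pos_pos) auto
    also have "\<dots> \<le> (M\<^sup>2 / 2) / (M * \<tau>)\<^sup>2"
      using M(2) by (intro divide_right_mono) (auto simp: max_def)
    also have "\<dots> = 1 / (2 * \<tau>\<^sup>2)" using M(1) \<tau>0 by (simp add: power_mult_distrib)
    finally show ?thesis .
  qed
  obtain U where "\<forall>x \<in> u ` past P0. norm x \<le> U"
    using compact_imp_bounded[OF compact_continuous_image[OF uc compact_past]] unfolding bounded_iff by blast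
  then have U: "\<And>z. z \<in> past P0 \<Longrightarrow> \<bar>u z\<bar> \<le> U" by simp
  obtain LF where LF: "LF \<ge> 0" "\<And>v. \<bar>v\<bar> \<le> U \<Longrightarrow> \<bar>F v\<bar> \<le> LF * \<bar>v\<bar>"
    using C1_lipschitz_at_zero[OF F(1,2)] by blast
  obtain VB where "VB > 0" "\<forall>x \<in> (\<lambda>z. V (fst z)) ` past P0. norm x \<le> VB"
    using compact_imp_bounded[OF compact_continuous_image[OF Vc compact_past]] unfolding bounded_pos by blast
  then have VB: "VB \<ge> 0" "\<And>z. z \<in> past P0 \<Longrightarrow> \<bar>V (fst z)\<bar> \<le> VB" by simp_all
  define L where "L = LF + VB + N / \<alpha>\<^sup>2"
  have N: "N \<ge> 0" by (simp add: N_def)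
  have L0: "L \<ge> 0" using LF VB N by (simp add: L_def)
  have w_u: "0 \<le> w z \<longleftrightarrow> 0 \<le> u z" "w z < 0 \<longleftrightarrow> u z < 0" if "z \<in> past P0" for z
    using dom(8)[OF that] by (auto simp: w_def zero_le_mult_iff mult_less_0_iff)
  have G_ge: "A * fst z powr m * u z powr p \<le> G z" if z: "z \<in> past P0" and "0 \<le> w z" for z
  proof -
    have u0: "0 \<le> u z" using w_u(1)[OF z] that by simp
    have "A * u z powr p \<le> F (u z)" by (rule F(3)[OF u0])
    also have "\<dots> \<le> F (u z) - V (fst z) * u z"
      using V(2)[OF dom(7)[OF z]] u0 by (simp add: mult_nonpos_nonneg)
    finally have "fst z powr m * (A * u z powr p) \<le> fst z powr m * (F (u z) - V (fst z) * u z)"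
      by (intro mult_left_mono) auto
    moreover have "0 \<le> N / (fst z)\<^sup>2 * w z" using N that by simp
    ultimately show ?thesis by (simp add: G_def mult.left_commute mult.assoc)
  qed
  have G_lower: "- L * max 0 (- w z) \<le> G z" if z: "z \<in> past P0" for z
  proof (cases "0 \<le> w z")
    case True
    have "0 \<le> A * fst z powr m * u z powr p" using A by simp
    then show ?thesis using G_ge[OF z True] True by simp
  next
    case False
    then have w0: "w z < 0" and u0: "u z < 0" using w_u(2)[OF z] by auto
    have "- F (u z) \<le> LF * (- u z)" using LF(2)[OF U[OF z]] u0 by simp
    then have "fst z powr m * (LF * u z) \<le> fst z powr m * F (u z)"
      by (intro mult_left_mono) auto
    then have 1: "LF * w z \<le> fst z powr m * F (u z)" by (simp add: w_def mult.left_commute)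
    have "V (fst z) \<ge> - VB" using VB(2)[OF z] by simp
    then have "VB * w z \<le> - V (fst z) * w z"
      using w0 by (intro mult_right_mono_neg) auto
    then have 2: "VB * w z \<le> - (fst z powr m * (V (fst z) * u z))" by (simp add: w_def mult.left_commute)
    have "\<alpha>\<^sup>2 \<le> (fst z)\<^sup>2" using dom(2)[OF z] \<alpha> by (intro power_mono) auto
    then have "N / (fst z)\<^sup>2 \<le> N / \<alpha>\<^sup>2" using N \<alpha> r0[OF z] by (intro divide_left_mono mult_pos_pos) auto
    then have 3: "N / \<alpha>\<^sup>2 * w z \<le> N / (fst z)\<^sup>2 * w z"
      using w0 by (intro mult_right_mono_neg) auto
    have "L * w z = LF * w z + VB * w z + N / \<alpha>\<^sup>2 * w z"
      by (simp only: L_def distrib_right)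
    also have "\<dots> \<le> fst z powr m * F (u z) + - (fst z powr m * (V (fst z) * u z)) + N / (fst z)\<^sup>2 * w z"
      by (intro add_mono 1 2 3)
    also have "\<dots> = G z" by (simp add: G_def right_diff_distrib)
    finally show ?thesis using w0 by (simp add: max_def)
  qed
  have q_nonneg: "0 \<le> q z" if "z \<in> past P0" for z by (simp add: q_def)
  have nonneg: "0 \<le> w P" and comp: "d P + (LINT z:past P|lborel. max 0 (G z)) \<le> 4 * w P"
    if "P \<in> past P0" for P
  proof -
    show "0 \<le> w P"
      by (rule duhamel_comparison(1)[where L = L and d = d, OF \<tau>0 _ wc Gc qc]; (fact eq d_nonneg d_mono q_nonneg q_le L0 G_lower that | simp add: P0_def))
    show "d P + (LINT z:past P|lborel. max 0 (G z)) \<le> 4 * w P"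
      by (rule duhamel_comparison(2)[where L = L and d = d, OF \<tau>0 _ wc Gc qc]; (fact eq d_nonneg d_mono q_nonneg q_le L0 G_lower that | simp add: P0_def))
  qed
  define \<kappa> where "\<kappa> = A / 4 * \<beta> powr (- m * (p - 1))"
  define B where "B = \<tau> * \<epsilon> * \<alpha> powr m * \<beta> powr (- k - 1) / 4"
  have \<kappa>0: "\<kappa> > 0" and B0: "B > 0" using A \<beta> \<alpha> \<tau>0 \<epsilon> by (auto simp: \<kappa>_def B_def)
  have wp_c: "continuous_on (past P0) (\<lambda>z. w z powr p)"
    using nonneg p by (intro continuous_on_powr' wc continuous_intros) auto
  have "\<kappa> * B powr (p - 1) * \<tau>\<^sup>2 \<le> 32 / (1 - \<theta>)\<^sup>2"
    unfolding \<theta>_def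
  proof (rule doubling_bound[OF \<tau>0 p \<kappa>0 B0, of "\<alpha> + \<tau>" w, folded P0_def])
    fix P assume P: "P \<in> past P0"
    have sub: "past P \<subseteq> past P0" using past_trans[OF P] .
    have "4 * \<kappa> * (LINT z:past P|lborel. w z powr p) = (LINT z:past P|lborel. (4 * \<kappa>) * w z powr p)"
      by simp
    also have "\<dots> \<le> (LINT z:past P|lborel. max 0 (G z))"
    proof (rule set_integral_mono)
      show "set_integrable lborel (past P) (\<lambda>z. (4 * \<kappa>) * w z powr p)"
        by (intro set_integrable_compact compact_past continuous_on_mult continuous_on_const continuous_on_subset[OF wp_c sub])
      show "set_integrable lborel (past P) (\<lambda>z. max 0 (G z))"
        by (intro set_integrable_compact compact_past continuous_on_max continuous_on_const continuous_on_subset[OF Gc sub])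
      fix z assume "z \<in> past P"
      then have z: "z \<in> past P0" using sub by auto
      have r: "fst z > 0" by (rule dom(8)[OF z])
      have u0: "u z \<ge> 0" using w_u(1)[OF z] nonneg[OF z] by simp
      have "w z powr p = fst z powr (m * p) * u z powr p"
        using r u0 by (simp add: w_def powr_mult powr_powr)
      moreover have "fst z powr (- m * (p - 1)) * fst z powr (m * p) = fst z powr m"
        by (simp add: algebra_simps flip: powr_add)
      ultimately have 1: "fst z powr (- m * (p - 1)) * w z powr p = fst z powr m * u z powr p"
        by (simp flip: mult.assoc)
      have "\<beta> powr (- m * (p - 1)) \<le> fst z powr (- m * (p - 1))"
        using r dom(3)[OF z] m p by (intro powr_mono2') (auto simp: mult_nonneg_nonneg)
      then have "A * (\<beta> powr (- m * (p - 1)) * w z powr p) \<le> A * (fst z powr (- m * (p - 1)) * w z powr p)"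
        using A by (intro mult_left_mono mult_right_mono) auto
      also have "\<dots> \<le> G z" using G_ge[OF z nonneg[OF z]] unfolding 1 by (simp add: mult.assoc)
      finally show "(4 * \<kappa>) * w z powr p \<le> max 0 (G z)" by (simp add: \<kappa>_def mult.assoc)
    qed
    also have "\<dots> \<le> 4 * w P" using comp[OF P] d_nonneg[OF P] by simp
    finally show "\<kappa> * (LINT z:past P|lborel. w z powr p) \<le> w P" by simp
    assume half: "(\<alpha> + \<tau>, \<tau> / 2) \<in> past P"
    define c where "c = \<epsilon> * \<alpha> powr m * \<beta> powr (- k - 1)"
    have c0: "c \<ge> 0" using \<epsilon> by (simp add: c_def)
    have tP: "\<tau> / 2 \<le> snd P" using half by (auto simp: past_def)
    have "\<tau> * c \<le> 2 * snd P * c" using tP c0 by (intro mult_right_mono) auto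
    also have "\<dots> = (LINT r:{fst P - snd P..fst P + snd P}|lborel. c)"
      using tP \<tau>0 by (subst set_integral_const_compact) auto
    also have "\<dots> \<le> d P"
      unfolding d_def
    proof (rule set_integral_mono)
      fix r assume r: "r \<in> {fst P - snd P..fst P + snd P}"
      then have r': "\<alpha> \<le> r" "r \<le> \<beta>" "R < r" using dom(1,4)[OF P] Rint[OF P r] by auto
      have \<beta>r: "\<beta> powr (- k - 1) \<le> r powr (- k - 1)"
        using r' \<alpha> k by (intro powr_mono2') auto
      have "\<alpha> powr m * (\<epsilon> * \<beta> powr (- k - 1)) \<le> r powr m * (\<epsilon> * r powr (- k - 1))"
      proof (rule mult_mono)
        show "\<alpha> powr m \<le> r powr m" using r' \<alpha> m by (intro powr_mono2) auto
        show "\<epsilon> * \<beta> powr (- k - 1) \<le> \<epsilon> * r powr (- k - 1)"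
          using \<epsilon> \<beta>r by (intro mult_left_mono) auto
      qed (use \<epsilon> in auto)
      also have "\<dots> \<le> r powr m * \<psi> r" using \<psi>(2)[OF r'(3)] by (intro mult_left_mono) auto
      finally show "c \<le> r powr m * \<psi> r" by (simp add: c_def mult.assoc mult.left_commute)
    qed (intro \<psi>int[OF P] set_integrable_compact continuous_on_const compact_Icc)+
    also have "\<dots> \<le> 4 * w P"
    proof -
      have "0 \<le> (LINT z:past P|lborel. max 0 (G z))"
        unfolding set_lebesgue_integral_def by (intro integral_nonneg_AE) (auto simp: indicator_def)
      then show ?thesis using comp[OF P] by simp
    qed
    finally show "B \<le> w P" by (simp add: B_def c_def mult.assoc)
  qed (use wc nonneg in auto)
  moreover have "A / 4 * ((1 / 3) powr m * ((M + 3) powr (- k - 1) / 4)) powr (p - 1)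
     * (\<epsilon> powr (p - 1) * \<tau> powr (2 - k * (p - 1))) \<le> \<kappa> * B powr (p - 1) * \<tau>\<^sup>2"
  proof -
    define D where "D = (1 / 3) powr m * ((M + 3) powr (- k - 1) / 4)"
    have D0: "D > 0" using M by (simp add: D_def)
    have e1: "\<beta> powr (- m * (p - 1)) = (\<beta> powr (- m)) powr (p - 1)" by (simp add: powr_powr)
    have "D * (\<epsilon> * \<tau> powr (- k)) = (1 / 3) powr m * (\<tau> * ((M + 3) powr (- k - 1) * \<tau> powr (- k - 1))) * (\<epsilon> / 4)"
    proof -
      have "\<tau> powr (- k) = \<tau> powr (1 + (- k - 1))" by simp
      also have "\<dots> = \<tau> * \<tau> powr (- k - 1)" using \<tau>0 by (subst powr_add) simp
      finally show ?thesis by (simp add: D_def)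
    qed
    also have "\<dots> \<le> (\<alpha> / \<beta>) powr m * (\<tau> * \<beta> powr (- k - 1)) * (\<epsilon> / 4)"
    proof (intro mult_right_mono mult_mono)
      show "(1 / 3) powr m \<le> (\<alpha> / \<beta>) powr m"
        using \<beta> \<alpha> m by (intro powr_mono2) (auto simp: field_simps)
      have "(M + 3) powr (- k - 1) * \<tau> powr (- k - 1) = ((M + 3) * \<tau>) powr (- k - 1)"
        using M \<tau>0 by (simp add: powr_mult)
      also have "\<dots> \<le> \<beta> powr (- k - 1)"
        using \<beta> k by (intro powr_mono2') auto
      finally show "(M + 3) powr (- k - 1) * \<tau> powr (- k - 1) \<le> \<beta> powr (- k - 1)" .
    qed (use \<tau>0 \<epsilon> in auto)
    also have "\<dots> = \<beta> powr (- m) * B"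
    proof -
      have "(\<alpha> / \<beta>) powr m = \<beta> powr (- m) * \<alpha> powr m"
        using \<alpha>(4) \<beta>(3) by (simp add: powr_divide powr_minus_divide)
      then show ?thesis by (simp add: B_def mult_ac)
    qed
    finally have "(D * (\<epsilon> * \<tau> powr (- k))) powr (p - 1) \<le> (\<beta> powr (- m) * B) powr (p - 1)"
      using D0 \<epsilon> p by (intro powr_mono2) auto
    then have "D powr (p - 1) * (\<epsilon> powr (p - 1) * \<tau> powr (- k * (p - 1)))
        \<le> \<beta> powr (- m * (p - 1)) * B powr (p - 1)"
      using D0 \<epsilon> B0 \<beta> \<tau>0 by (simp add: powr_mult powr_powr)
    then have "A / 4 * \<tau>\<^sup>2 * (D powr (p - 1) * (\<epsilon> powr (p - 1) * \<tau> powr (- k * (p - 1))))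
        \<le> A / 4 * \<tau>\<^sup>2 * (\<beta> powr (- m * (p - 1)) * B powr (p - 1))"
      using A by (intro mult_left_mono) auto
    moreover have "\<tau> powr (2 - k * (p - 1)) = \<tau>\<^sup>2 * \<tau> powr (- k * (p - 1))"
    proof -
      have "\<tau> powr (2 - k * (p - 1)) = \<tau> powr (2 + - k * (p - 1))" by simp
      also have "\<dots> = \<tau>\<^sup>2 * \<tau> powr (- k * (p - 1))" using \<tau>0 by (subst powr_add) (simp add: powr_realpow)
      finally show ?thesis .
    qed
    ultimately show ?thesis unfolding D_def[symmetric] \<kappa>_def by (simp add: mult_ac)
  qed
  ultimately show ?thesis by (rule order_trans[rotated])
qed

theorem theorem5p5:
  fixes n :: nat and R A p k \<epsilon>0 :: real and F V :: "real \<Rightarrow> real"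
  assumes "n \<ge> 1" and "R > 0"
    and "F C1_differentiable_on UNIV" and "F 0 = 0"
    and "\<And>u. u \<ge> 0 \<Longrightarrow> deriv F u \<ge> 0"
    and "A > 0" and "p > 1"
    and "\<And>u. u \<ge> 0 \<Longrightarrow> F u \<ge> A * u powr p"
    and "V C1_differentiable_on {R<..}"
    and "\<And>r. r > R \<Longrightarrow> V r \<le> 0"
    and "0 \<le> k" and "k < 2 / (p - 1)"
    and "\<epsilon>0 > 0"
  shows "\<exists>C>0. \<forall>\<epsilon> \<psi>.
           0 < \<epsilon> \<and> \<epsilon> \<le> \<epsilon>0 \<and>
           continuous_on {R<..} \<psi> \<and> (\<forall>r>R. \<psi> r \<ge> \<epsilon> * r powr (- k - 1)) \<longrightarrow>
           lifespan n R (\<lambda>r u. F u - V r * u) \<psi>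
             \<le> ennreal (C * \<epsilon> powr (- (p - 1) / (2 - k * (p - 1))))"
proof -
  define m where "m = (real n - 1) / 2"
  \<comment> \<open>With this \<open>M\<close> the potential is at most \<open>1 / (2 * \<tau>^2)\<close> at radii above \<open>M * \<tau>\<close>.\<close>
  define M where "M = 1 + 2 * \<bar>m * (m - 1)\<bar>"
  define \<theta> where "\<theta> = (2::real) powr (- (p - 1) / 2)"
  define \<gamma> where "\<gamma> = 2 - k * (p - 1)"
  define c where "c = A / 4 * ((1 / 3) powr m * ((M + 3) powr (- k - 1) / 4)) powr (p - 1)"
  define K where "K = 32 / (1 - \<theta>)\<^sup>2 / c"
  define e where "e = - (p - 1) / \<gamma>"
  \<comment> \<open>The second summand covers times below \<open>R\<close>, where the estimate is not available; this is where \<open>\<epsilon> \<le> \<epsilon>0\<close> enters.\<close>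
  define C where "C = K powr (1 / \<gamma>) + R * \<epsilon>0 powr (- e)"
  have M: "M \<ge> 1" "2 * (m * (m - 1)) \<le> M\<^sup>2"
  proof -
    show "M \<ge> 1" by (simp add: M_def)
    have "2 * (m * (m - 1)) \<le> M" using abs_ge_self[of "m * (m - 1)"] by (simp add: M_def)
    also have "M \<le> M\<^sup>2" using \<open>M \<ge> 1\<close> by (simp add: power2_eq_square)
    finally show "2 * (m * (m - 1)) \<le> M\<^sup>2" .
  qed
  have \<gamma>: "\<gamma> > 0" using \<open>k < 2 / (p - 1)\<close> \<open>p > 1\<close> by (simp add: \<gamma>_def field_simps)
  have c: "c > 0" using M \<open>A > 0\<close> by (simp add: c_def)
  have \<theta>: "\<theta> < 1" using \<open>p > 1\<close> by (simp add: \<theta>_def powr_less_one)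
  have K: "K > 0" using c \<theta> by (simp add: K_def)
  have e: "e < 0" using \<gamma> \<open>p > 1\<close> by (simp add: e_def divide_neg_pos)
  have Vc: "continuous_on {R<..} V" using assms(9) by (rule C1_differentiable_imp_continuous_on)
  have bound: "\<tau> \<le> C * \<epsilon> powr e"
    if \<epsilon>: "0 < \<epsilon>" "\<epsilon> \<le> \<epsilon>0" and \<psi>: "continuous_on {R<..} \<psi>" "\<And>r. r > R \<Longrightarrow> \<psi> r \<ge> \<epsilon> * r powr (- k - 1)"
      and sol: "is_solution n R T (\<lambda>r u. F u - V r * u) \<psi> u" and \<tau>: "\<tau> < T" for \<epsilon> \<psi> u T \<tau>
  proof (cases "R \<le> \<tau>")
    case True
    then have \<tau>0: "\<tau> > 0" using \<open>R > 0\<close> by simp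
    have "c * (\<epsilon> powr (p - 1) * \<tau> powr \<gamma>) \<le> 32 / (1 - \<theta>)\<^sup>2"
      unfolding c_def \<theta>_def \<gamma>_def m_def
      by (rule wave_blowup_estimate[OF assms(1-4) assms(8,6,7) Vc assms(10,11) \<epsilon>(1) \<psi> sol True \<tau> M[unfolded m_def]])
    then have "\<epsilon> powr (p - 1) * \<tau> powr \<gamma> \<le> K"
      unfolding K_def pos_le_divide_eq[OF c] by (simp only: mult_ac)
    then have "(\<epsilon> powr (p - 1) * \<tau> powr \<gamma>) * \<epsilon> powr (- (p - 1)) \<le> K * \<epsilon> powr (- (p - 1))"
      by (rule mult_right_mono) simp
    moreover have "(\<epsilon> powr (p - 1) * \<tau> powr \<gamma>) * \<epsilon> powr (- (p - 1))
        = \<tau> powr \<gamma> * \<epsilon> powr (p - 1 + - (p - 1))"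
      unfolding powr_add by (simp only: mult_ac)
    moreover have "\<epsilon> powr (p - 1 + - (p - 1)) = 1" using \<epsilon> by simp
    ultimately have \<tau>\<gamma>: "\<tau> powr \<gamma> \<le> K * \<epsilon> powr (- (p - 1))"
      by (simp only: mult_1_right)
    have "(\<tau> powr \<gamma>) powr (1 / \<gamma>) \<le> (K * \<epsilon> powr (- (p - 1))) powr (1 / \<gamma>)"
      by (rule powr_mono2[OF _ powr_ge_zero \<tau>\<gamma>]) (use \<gamma> in simp)
    then have "\<tau> \<le> K powr (1 / \<gamma>) * \<epsilon> powr e"
      using \<gamma> \<tau>0 K by (simp add: powr_powr powr_mult e_def)
    also have "\<dots> \<le> C * \<epsilon> powr e"
      unfolding C_def using \<open>R > 0\<close> by (intro mult_right_mono) auto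
    finally show ?thesis .
  next
    case False
    have "\<epsilon>0 powr e \<le> \<epsilon> powr e" using \<epsilon> e by (intro powr_mono2') auto
    have "\<tau> \<le> R * (\<epsilon>0 powr (- e) * \<epsilon>0 powr e)"
      using False \<open>\<epsilon>0 > 0\<close> by (simp flip: powr_add)
    also have "\<dots> \<le> R * (\<epsilon>0 powr (- e) * \<epsilon> powr e)"
      using \<open>\<epsilon>0 powr e \<le> \<epsilon> powr e\<close> \<open>R > 0\<close> by (intro mult_left_mono) auto
    also have "\<dots> \<le> C * \<epsilon> powr e"
      unfolding C_def by (simp add: distrib_right)
    finally show ?thesis .
  qed
  have "lifespan n R (\<lambda>r u. F u - V r * u) \<psi> \<le> ennreal (C * \<epsilon> powr e)"
    if data: "0 < \<epsilon> \<and> \<epsilon> \<le> \<epsilon>0 \<and> continuous_on {R<..} \<psi> \<and> (\<forall>r>R. \<psi> r \<ge> \<epsilon> * r powr (- k - 1))" for \<epsilon> \<psi>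
    unfolding lifespan_def
  proof (rule SUP_least)
    fix T assume "T \<in> {T. 0 < T \<and> (\<exists>u. is_solution n R T (\<lambda>r u. F u - V r * u) \<psi> u)}"
    then obtain u where sol: "is_solution n R T (\<lambda>r u. F u - V r * u) \<psi> u" by blast
    have "T \<le> C * \<epsilon> powr e"
    proof (rule dense_le)
      show "\<tau> \<le> C * \<epsilon> powr e" if "\<tau> < T" for \<tau>
        by (rule bound[OF _ _ _ _ sol that]) (use data in auto)
    qed
    then show "ennreal T \<le> ennreal (C * \<epsilon> powr e)" by (rule ennreal_leI)
  qed
  moreover have "C > 0"
    unfolding C_def using K \<open>R > 0\<close> by (intro add_pos_nonneg) auto
  ultimately show ?thesis unfolding e_def \<gamma>_def by blast
qed

end
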